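(* Let $f:\Omega_n\to[0,1]$ be monotone. Then $$I\!I(f)\le C\,\Lambda(f)^2\bigl(1-\log\Lambda(f)\bigr)\log n ,$$ where $C$ is some universal constant. Consequently, if $\mathcal{A}_m\subset\Omega_{n_m}$ is a sequence of monotone events with $$\lim_{m\to\infty}\Lambda(\mathcal{A}_m)^2\bigl(1-\log\Lambda(\mathcal{A}_m)\bigr)\log n_m=0,$$ then $\{\mathcal{A}_m\}$ is asymptotically noise sensitive.
   Context: $\Omega_n=\{0,1\}^n$ carries the uniform probability measure $\mathbf{P}$, with expectation $\mathbf{E}$; an event is a subset $\mathcal{A}\subset\Omega_n$. A function $f:\Omega_n\to\mathbb{R}$ is monotone if $f(x)\le f(y)$ whenever $x_j\le y_j$ for all $j$; an event is monotone if its indicator function $\chi_{\mathcal{A}}$ is monotone. Majority: for $K\subset\{1,\dots,n\}$, $M_K(x)=\mathrm{sign}\sum_{j\in K}(2x_j-1)$, with $\mathrm{sign}(0)=0$. For $f:\Omega_n\to\mathbb{R}$, $\Lambda(f)=\max\{|\mathbf{E}(fM_K)|:K\subset\{1,\dots,n\}\}$, and $\Lambda(\mathcal{A})=\Lambda(\chi_{\mathcal{A}})$. The expression $\Lambda^2(1-\log\Lambda)$ is read as $0$ when $\Lambda=0$. Influences: for $x\in\Omega_n$ and $j\in\{1,\dots,n\}$, $\sigma_jx$ is $x$ with the $j$-th coordinate replaced by $1-x_j$; $I_k(f)=\mathbf{E}|f(\sigma_kx)-f(x)|$ and $I\!I(f)=\sum_{k=1}^n I_k(f)^2$. Noise: for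 $x\in\Omega_n$ and $\epsilon\in(0,1)$, $N_\epsilon(x)$ is the random element of $\Omega_n$ whose coordinates are, independently, $x_j$ with probability $1-\epsilon$ and $1-x_j$ with probability $\epsilon$. Sensitivity gauge: for an event $\mathcal{A}\subset\Omega_n$ and $\delta>0$, let $$\gamma(\mathcal{A},\epsilon,\delta)=\mathbf{P}\Bigl\{x\in\Omega_n:\bigl|\mathbf{P}(N_\epsilon(x)\in\mathcal{A}\mid x)-\mathbf{P}(\mathcal{A})\bigr|>\delta\Bigr\},\qquad \phi(\mathcal{A},\epsilon)=\inf\{\delta>0:\gamma(\mathcal{A},\epsilon,\delta)<\delta\}.$$ A sequence of events $\mathcal{A}_m\subset\Omega_{n_m}$ is asymptotically noise sensitive if $\lim_{m\to\infty}\phi(\mathcal{A}_m,\epsilon)=0$ for every $\epsilon\in(0,1/2)$.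
   Formalization: The formal theorem assumes n ≥ 2 in the first part and n_m ≥ 2 for every m in the second; for n = 1 the claim fails, since f(x) = x_1 has II(f) = 1 while log n = 0, and for n = 0 log n is undefined. *)

theory Defs
  imports "HOL-Probability.Probability"
begin

text \<open>Points of the cube are extensional functions on \<open>{1..n}\<close>, that is, they are
  \<open>undefined\<close> outside \<open>{1..n}\<close>, so that two points with the same coordinates are equal.\<close>

definition cube :: "nat \<Rightarrow> (nat \<Rightarrow> nat) set" where
  "cube n = ({1..n} \<rightarrow>\<^sub>E {0, 1})"

lemma finite_cube [simp]: "finite (cube n)"
  unfolding cube_def by (intro finite_PiE) auto

lemma cube_nonempty [simp]: "cube n \<noteq> {}"
  unfolding cube_def by (simp add: PiE_eq_empty_iff)

definition uniform_cube :: "nat \<Rightarrow> (nat \<Rightarrow> nat) pmf" where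
  "uniform_cube n = pmf_of_set (cube n)"

abbreviation cube_prob :: "nat \<Rightarrow> (nat \<Rightarrow> nat) set \<Rightarrow> real" where
  "cube_prob n \<equiv> measure_pmf.prob (uniform_cube n)"

abbreviation cube_expectation :: "nat \<Rightarrow> ((nat \<Rightarrow> nat) \<Rightarrow> real) \<Rightarrow> real" where
  "cube_expectation n \<equiv> measure_pmf.expectation (uniform_cube n)"

definition cube_monotone :: "nat \<Rightarrow> ((nat \<Rightarrow> nat) \<Rightarrow> real) \<Rightarrow> bool" where
  "cube_monotone n f \<longleftrightarrow> monotone_on (cube n) (\<lambda>x y. \<forall>j\<in>{1..n}. x j \<le> y j) (\<le>) f"

definition monotone_event :: "nat \<Rightarrow> (nat \<Rightarrow> nat) set \<Rightarrow> bool" where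
  "monotone_event n A \<longleftrightarrow> A \<subseteq> cube n \<and> cube_monotone n (indicat_real A)"

definition majority :: "nat set \<Rightarrow> (nat \<Rightarrow> nat) \<Rightarrow> real" where
  "majority K x = sgn (\<Sum>j\<in>K. (2 * real (x j) - 1))"

definition Lam :: "nat \<Rightarrow> ((nat \<Rightarrow> nat) \<Rightarrow> real) \<Rightarrow> real" where
  "Lam n f = Max ((\<lambda>K. \<bar>cube_expectation n (\<lambda>x. f x * majority K x)\<bar>) ` Pow {1..n})"

definition flip :: "nat \<Rightarrow> (nat \<Rightarrow> nat) \<Rightarrow> (nat \<Rightarrow> nat)" where
  "flip j x = x(j := 1 - x j)"

definition influence :: "nat \<Rightarrow> nat \<Rightarrow> ((nat \<Rightarrow> nat) \<Rightarrow> real) \<Rightarrow> real" where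
  "influence n k f = cube_expectation n (\<lambda>x. \<bar>f (flip k x) - f x\<bar>)"

definition sum_sq_influences :: "nat \<Rightarrow> ((nat \<Rightarrow> nat) \<Rightarrow> real) \<Rightarrow> real" where
  "sum_sq_influences n f = (\<Sum>k\<in>{1..n}. (influence n k f)\<^sup>2)"

text \<open>The law of \<open>N\<^sub>\<epsilon>(x)\<close>. The default value \<open>undefined\<close> outside \<open>{1..n}\<close> is the one
  used by the extensional function space, so this law is supported on \<open>cube n\<close>.\<close>

definition noise :: "nat \<Rightarrow> real \<Rightarrow> (nat \<Rightarrow> nat) \<Rightarrow> (nat \<Rightarrow> nat) pmf" where
  "noise n \<epsilon> x = Pi_pmf {1..n} undefined
     (\<lambda>j. map_pmf (\<lambda>b. if b then 1 - x j else x j) (bernoulli_pmf \<epsilon>))"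

definition sens_gamma :: "nat \<Rightarrow> (nat \<Rightarrow> nat) set \<Rightarrow> real \<Rightarrow> real \<Rightarrow> real" where
  "sens_gamma n A \<epsilon> \<delta> =
     cube_prob n {x \<in> cube n. \<bar>measure_pmf.prob (noise n \<epsilon> x) A - cube_prob n A\<bar> > \<delta>}"

definition sens_phi :: "nat \<Rightarrow> (nat \<Rightarrow> nat) set \<Rightarrow> real \<Rightarrow> real" where
  "sens_phi n A \<epsilon> = Inf {\<delta>. \<delta> > 0 \<and> sens_gamma n A \<epsilon> \<delta> < \<delta>}"

definition asymp_noise_sensitive :: "(nat \<Rightarrow> nat) \<Rightarrow> (nat \<Rightarrow> (nat \<Rightarrow> nat) set) \<Rightarrow> bool" where
  "asymp_noise_sensitive N A \<longleftrightarrow>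
     (\<forall>\<epsilon>. 0 < \<epsilon> \<and> \<epsilon> < 1 / 2 \<longrightarrow> (\<lambda>m. sens_phi (N m) (A m) \<epsilon>) \<longlonglongrightarrow> 0)"

text \<open>Since \<open>ln 0 = 0\<close> in HOL, \<open>l\<^sup>2 * (1 - ln l)\<close> has its conventional value 0 at \<open>l = 0\<close>.\<close>

definition Lam_term :: "real \<Rightarrow> real" where
  "Lam_term l = l\<^sup>2 * (1 - ln l)"

end

theory Submission
  imports Defs
begin

text \<open>Let \<open>S\<^sub>K\<close> be the sum of the spins \<open>2 x\<^sub>j - 1\<close> over \<open>K\<close>. For monotone \<open>f\<close> the influences over \<open>K\<close> add up to
  \<open>2 E(f S\<^sub>K)\<close>. The averages of \<open>f\<close> over the levels of \<open>S\<^sub>K\<close> increase, so \<open>E(f S\<^sub>K)\<close> is at most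
  \<open>T E(f M\<^sub>K)\<close> plus the Gaussian tail of \<open>|S\<^sub>K|\<close> beyond \<open>T\<close>; taking \<open>T\<close> of order \<open>\<surd>(|K| (1 - ln \<Lambda>))\<close> bounds the
  sum by a multiple of \<open>\<Lambda> \<surd>(1 - ln \<Lambda>) \<surd>|K|\<close>. Hence the \<open>k\<close>-th largest influence is at most a multiple of
  \<open>\<Lambda> \<surd>(1 - ln \<Lambda>) / \<surd>k\<close>, and the harmonic sum gives the factor \<open>ln n\<close>.

  Noise sensitivity follows from \<open>II(f) \<rightarrow> 0\<close>. For \<open>I \<subseteq> {1..n}\<close> the degree-one coefficients \<open>F\<^sub>i\<close>, \<open>i \<in> I\<close>, of \<open>f\<close>
  restricted to the coordinates in \<open>I\<close> are nonnegative functions of the other coordinates with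
  \<open>\<Sum> F\<^sub>i\<^sup>2 \<le> 1\<close> and with means equal to half the influences. Truncating the noised \<open>F\<^sub>i\<close>
  at \<open>t\<close> times its \<open>L\<^sup>2\<close> norm and using the \<open>L\<^sup>2\<close>-\<open>L\<^sup>4\<close> hypercontractive inequality bounds the noisy weight of the
  sets that meet \<open>I\<close> in one point by \<open>t \<surd>II(f) + 1/t\<close>; averaging over \<open>I\<close> reaches all nonempty sets.\<close>

section \<open>Expectations on the cube\<close>

lemma set_pmf_uniform_cube [simp]: "set_pmf (uniform_cube n) = cube n"
  by (simp add: uniform_cube_def)

lemma integrable_uniform_cube [simp]:
  "integrable (measure_pmf (uniform_cube n)) (f :: _ \<Rightarrow> real)"
  by (rule integrable_measure_pmf_finite) simp

lemma card_cube: "card (cube n) = 2 ^ n"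
  by (simp add: cube_def card_PiE numeral_2_eq_2)

lemma cube_expectation_eq_sum: "cube_expectation n f = (\<Sum>x\<in>cube n. f x) / 2 ^ n"
  unfolding uniform_cube_def
  by (subst integral_pmf_of_set) (auto simp: card_cube)

lemma cube_expectation_cong:
  "(\<And>x. x \<in> cube n \<Longrightarrow> f x = g x) \<Longrightarrow> cube_expectation n f = cube_expectation n g"
  by (simp add: cube_expectation_eq_sum)

lemma cube_expectation_mono:
  "(\<And>x. x \<in> cube n \<Longrightarrow> f x \<le> g x) \<Longrightarrow> cube_expectation n f \<le> cube_expectation n g"
  by (simp add: cube_expectation_eq_sum sum_mono divide_right_mono)

lemma cube_expectation_nonneg:
  "(\<And>x. x \<in> cube n \<Longrightarrow> 0 \<le> f x) \<Longrightarrow> 0 \<le> cube_expectation n f"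
  by (simp add: cube_expectation_eq_sum sum_nonneg)

lemma cube_values:
  assumes "x \<in> cube n" "j \<in> {1..n}"
  shows "x j = 0 \<or> x j = 1"
  using assms unfolding cube_def by (blast dest: PiE_mem)

lemma flip_in_cube [simp]:
  assumes "x \<in> cube n" "j \<in> {1..n}"
  shows "flip j x \<in> cube n"
  using assms cube_values[OF assms] unfolding flip_def cube_def
  by (auto simp: PiE_iff extensional_def)

lemma flip_flip:
  assumes "x \<in> cube n" "j \<in> {1..n}"
  shows "flip j (flip j x) = x"
  using cube_values[OF assms] by (auto simp: flip_def)

lemma bij_betw_flip:
  assumes "j \<in> {1..n}"
  shows "bij_betw (flip j) (cube n) (cube n)"
  using assms by (intro bij_betwI[where g = "flip j"]) (auto simp: flip_flip)

lemma cube_expectation_flip: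
  assumes "j \<in> {1..n}"
  shows "cube_expectation n (\<lambda>x. f (flip j x)) = cube_expectation n f"
  unfolding cube_expectation_eq_sum
  using sum.reindex_bij_betw[OF bij_betw_flip[OF assms], of f] by simp

text \<open>Flipping one coordinate preserves the uniform measure, so the expectation equals its own
  negative. This symmetry stands in for independence of the coordinates: it gives the orthogonality
  of Walsh functions and removes the odd terms from fourth and exponential moments.\<close>

lemma cube_expectation_odd:
  assumes "j \<in> {1..n}" "\<And>x. x \<in> cube n \<Longrightarrow> f (flip j x) = - f x"
  shows "cube_expectation n f = 0"
proof -
  have "cube_expectation n f = cube_expectation n (\<lambda>x. f (flip j x))"
    using cube_expectation_flip[OF assms(1)] by simp
  also have "\<dots> = - cube_expectation n f"
    using assms(2) cube_expectation_cong[of n "\<lambda>x. f (flip j x)" "\<lambda>x. - f x"] by simp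
  finally show ?thesis by simp
qed

definition spin :: "nat \<Rightarrow> (nat \<Rightarrow> nat) \<Rightarrow> real" where
  "spin j x = 2 * real (x j) - 1"

lemma spin_flip:
  assumes "x \<in> cube n" "j \<in> {1..n}"
  shows "spin i (flip j x) = (if i = j then - spin i x else spin i x)"
  using cube_values[OF assms] by (auto simp: spin_def flip_def)

lemma spin_cases:
  assumes "x \<in> cube n" "j \<in> {1..n}"
  shows "spin j x = 1 \<or> spin j x = -1"
  using cube_values[OF assms] by (auto simp: spin_def)

lemma spin_square:
  assumes "x \<in> cube n" "j \<in> {1..n}"
  shows "(spin j x)\<^sup>2 = 1"
  using spin_cases[OF assms] by auto

section \<open>Walsh functions\<close>

definition walsh :: "nat set \<Rightarrow> (nat \<Rightarrow> nat) \<Rightarrow> real" where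
  "walsh S x = (\<Prod>j\<in>S. spin j x)"

definition walsh_coeff :: "nat \<Rightarrow> ((nat \<Rightarrow> nat) \<Rightarrow> real) \<Rightarrow> nat set \<Rightarrow> real" where
  "walsh_coeff n f S = cube_expectation n (\<lambda>x. f x * walsh S x)"

lemma walsh_empty [simp]: "walsh {} x = 1"
  by (simp add: walsh_def)

lemma walsh_insert:
  "finite S \<Longrightarrow> v \<notin> S \<Longrightarrow> walsh (insert v S) x = spin v x * walsh S x"
  by (simp add: walsh_def)

lemma walsh_flip:
  assumes "x \<in> cube n" "j \<in> {1..n}" "finite S"
  shows "walsh S (flip j x) = (if j \<in> S then - walsh S x else walsh S x)"
proof (cases "j \<in> S")
  case True
  then have "S = insert j (S - {j})" by auto
  moreover have "(\<Prod>i\<in>S - {j}. spin i (flip j x)) = (\<Prod>i\<in>S - {j}. spin i x)"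
    by (intro prod.cong) (auto simp: spin_flip[OF assms(1,2)])
  ultimately show ?thesis
    using True assms(3) spin_flip[OF assms(1,2), of j]
    by (simp add: walsh_def prod.remove[of S j])
next
  case False
  then show ?thesis
    unfolding walsh_def by (auto intro!: prod.cong simp: spin_flip[OF assms(1,2)])
qed

lemma walsh_square:
  assumes "x \<in> cube n" "S \<subseteq> {1..n}"
  shows "walsh S x * walsh S x = 1"
proof -
  have "walsh S x * walsh S x = (\<Prod>j\<in>S. (spin j x)\<^sup>2)"
    by (simp add: walsh_def prod.distrib power2_eq_square)
  also have "\<dots> = 1"
    using assms by (intro prod.neutral) (auto simp: spin_square)
  finally show ?thesis .
qed

text \<open>If the two sets differ, a coordinate \<open>v\<close> lying in exactly one of them makes
  the product odd under flipping \<open>v\<close>.\<close>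

lemma walsh_orthonormal:
  assumes "S \<subseteq> {1..n}" "R \<subseteq> {1..n}"
  shows "cube_expectation n (\<lambda>x. walsh S x * walsh R x) = (if S = R then 1 else 0)"
proof (cases "S = R")
  case True
  then have "cube_expectation n (\<lambda>x. walsh S x * walsh R x) = cube_expectation n (\<lambda>_. 1)"
    using assms by (intro cube_expectation_cong) (simp add: walsh_square)
  with True show ?thesis by simp
next
  case False
  then obtain v where v: "(v \<in> S) \<noteq> (v \<in> R)" by blast
  then have vn: "v \<in> {1..n}" using assms by blast
  have fin: "finite S" "finite R" using assms finite_subset by blast+
  have "cube_expectation n (\<lambda>x. walsh S x * walsh R x) = 0"
    using v by (intro cube_expectation_odd[OF vn]) (auto simp: walsh_flip[OF _ vn] fin)
  with False show ?thesis by simp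
qed

lemma walsh_sum_square:
  assumes "F \<subseteq> Pow {1..n}"
  shows "cube_expectation n (\<lambda>x. (\<Sum>S\<in>F. a S * walsh S x)\<^sup>2) = (\<Sum>S\<in>F. (a S)\<^sup>2)"
proof -
  have fin: "finite F" using assms finite_subset by blast
  have "cube_expectation n (\<lambda>x. (\<Sum>S\<in>F. a S * walsh S x)\<^sup>2) =
      cube_expectation n (\<lambda>x. \<Sum>S\<in>F. \<Sum>R\<in>F. a S * a R * (walsh S x * walsh R x))"
    by (simp add: power2_eq_square sum_product mult_ac)
  also have "\<dots> = (\<Sum>S\<in>F. \<Sum>R\<in>F. a S * a R * cube_expectation n (\<lambda>x. walsh S x * walsh R x))"
    by simp
  also have "\<dots> = (\<Sum>S\<in>F. \<Sum>R\<in>F. if S = R then a S * a R else 0)"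
  proof (intro sum.cong refl)
    fix S R assume "S \<in> F" "R \<in> F"
    then have "S \<subseteq> {1..n}" "R \<subseteq> {1..n}" using assms by auto
    from walsh_orthonormal[OF this]
    show "a S * a R * cube_expectation n (\<lambda>x. walsh S x * walsh R x) = (if S = R then a S * a R else 0)"
      by simp
  qed
  also have "\<dots> = (\<Sum>S\<in>F. (a S)\<^sup>2)"
    using fin by (simp add: power2_eq_square)
  finally show ?thesis .
qed

text \<open>Bessel's inequality: \<open>?g\<close> is the orthogonal projection of \<open>f\<close>
  onto the span of the Walsh functions indexed by \<open>F\<close>, and the mean square of
  \<open>f - ?g\<close> is nonnegative.\<close>

lemma walsh_bessel:
  assumes "F \<subseteq> Pow {1..n}"
  shows "(\<Sum>S\<in>F. (walsh_coeff n f S)\<^sup>2) \<le> cube_expectation n (\<lambda>x. (f x)\<^sup>2)"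
proof -
  let ?g = "\<lambda>x. \<Sum>S\<in>F. walsh_coeff n f S * walsh S x"
  have "cube_expectation n (\<lambda>x. f x * ?g x) =
      cube_expectation n (\<lambda>x. \<Sum>S\<in>F. walsh_coeff n f S * (f x * walsh S x))"
    by (simp add: sum_distrib_left mult_ac)
  also have "\<dots> = (\<Sum>S\<in>F. (walsh_coeff n f S)\<^sup>2)"
    by (simp add: walsh_coeff_def power2_eq_square)
  finally have cross: "cube_expectation n (\<lambda>x. f x * ?g x) = (\<Sum>S\<in>F. (walsh_coeff n f S)\<^sup>2)" .
  have "0 \<le> cube_expectation n (\<lambda>x. (f x - ?g x)\<^sup>2)"
    by (intro cube_expectation_nonneg) simp
  also have "\<dots> = cube_expectation n (\<lambda>x. (f x)\<^sup>2 - 2 * (f x * ?g x) + (?g x)\<^sup>2)"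
    by (simp add: power2_eq_square algebra_simps)
  also have "\<dots> = cube_expectation n (\<lambda>x. (f x)\<^sup>2) - 2 * cube_expectation n (\<lambda>x. f x * ?g x)
      + cube_expectation n (\<lambda>x. (?g x)\<^sup>2)"
    by simp
  finally show ?thesis
    using cross walsh_sum_square[OF assms, of "walsh_coeff n f"] by simp
qed

section \<open>Cauchy-Schwarz and hypercontractivity\<close>

lemma cube_expectation_Cauchy_Schwarz:
  "(cube_expectation n (\<lambda>x. g x * h x))\<^sup>2 \<le>
    cube_expectation n (\<lambda>x. (g x)\<^sup>2) * cube_expectation n (\<lambda>x. (h x)\<^sup>2)"
proof -
  have "(\<Sum>x\<in>cube n. g x * h x)\<^sup>2 \<le> (\<Sum>x\<in>cube n. (g x)\<^sup>2) * (\<Sum>x\<in>cube n. (h x)\<^sup>2)"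
    by (rule Cauchy_Schwarz_ineq_sum)
  then show ?thesis
    by (simp add: cube_expectation_eq_sum power_divide divide_right_mono power2_eq_square[of "2^n"])
qed

text \<open>The Bonami inequality: the noise operator with parameter \<open>r = 1/\<surd>3\<close> is a contraction
  from \<open>L\<^sup>2\<close> to \<open>L\<^sup>4\<close>.\<close>

lemma bonami:
  assumes "V \<subseteq> {1..n}" "r\<^sup>2 = (1/3 :: real)"
  shows "cube_expectation n (\<lambda>x. (\<Sum>S\<in>Pow V. r ^ card S * c S * walsh S x) ^ 4)
      \<le> (\<Sum>S\<in>Pow V. (c S)\<^sup>2)\<^sup>2"
proof -
  have "finite V" using assms(1) finite_subset by blast
  then show ?thesis using assms(1)
  proof (induction V arbitrary: c rule: finite_induct)
    case empty
    then show ?case by (simp flip: power_mult)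
  next
    case (insert v V)
    \<comment> \<open>Separating the sets without \<open>v\<close> from those with \<open>v\<close>
      writes the Walsh sum as \<open>?A + r * spin v * ?B\<close>, where neither \<open>?A\<close>
      nor \<open>?B\<close> depends on the coordinate \<open>v\<close>.\<close>
    let ?A = "\<lambda>x. \<Sum>S\<in>Pow V. r ^ card S * c S * walsh S x"
    let ?B = "\<lambda>x. \<Sum>S\<in>Pow V. r ^ card S * c (insert v S) * walsh S x"
    define a where "a = (\<Sum>S\<in>Pow V. (c S)\<^sup>2)"
    define b where "b = (\<Sum>S\<in>Pow V. (c (insert v S))\<^sup>2)"
    have vn: "v \<in> {1..n}" and Vn: "V \<subseteq> {1..n}" using insert.prems by auto
    have disj: "Pow V \<inter> insert v ` Pow V = {}" using insert.hyps by blast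
    have inj: "inj_on (insert v) (Pow V)"
      using insert.hyps by (auto simp: inj_on_def dest: insert_ident)
    have split: "(\<Sum>S\<in>Pow (insert v V). g S) = (\<Sum>S\<in>Pow V. g S) + (\<Sum>S\<in>Pow V. g (insert v S))"
      for g :: "nat set \<Rightarrow> real"
      using insert.hyps disj inj by (simp add: Pow_insert sum.union_disjoint sum.reindex)
    have finS: "finite S" "v \<notin> S" if "S \<in> Pow V" for S
      using that insert.hyps finite_subset by auto
    have expand: "(\<Sum>S\<in>Pow (insert v V). r ^ card S * c S * walsh S x) = ?A x + r * spin v x * ?B x" for x
      unfolding split by (simp add: sum_distrib_left finS walsh_insert mult_ac)
    have Aflip: "?A (flip v x) = ?A x" and Bflip: "?B (flip v x) = ?B x" if "x \<in> cube n" for x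
      using that finS by (auto intro!: sum.cong simp: walsh_flip[OF _ vn])
    \<comment> \<open>The terms odd in \<open>s\<close> are collected at the end and average out
      over the coordinate \<open>v\<close>. The value 1/3 of \<open>r\<^sup>2\<close> turns the
      mixed coefficient 6 into 2, the coefficient in the square of \<open>a + b\<close>.\<close>
    have quartic: "(A + r * s * B) ^ 4 =
        A ^ 4 + 2 * (A\<^sup>2 * B\<^sup>2) + B ^ 4 / 9 + s * (4 * r * A ^ 3 * B + 4 / 3 * r * A * B ^ 3)"
      if "s\<^sup>2 = 1" for A B s :: real
    proof -
      have s: "s * s = 1" and r: "r * r = 1 / 3" using that assms(2) by (simp_all add: power2_eq_square)
      have "(A + r * s * B) ^ 4 = A ^ 4 + 6 * (r * r) * (s * s) * (A\<^sup>2 * B\<^sup>2)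
          + (r * r) * (r * r) * (s * s) * (s * s) * B ^ 4
          + s * (4 * r * A ^ 3 * B + 4 * (r * r) * r * (s * s) * A * B ^ 3)"
        by algebra
      then show ?thesis by (simp add: s r)
    qed
    have "cube_expectation n (\<lambda>x. (\<Sum>S\<in>Pow (insert v V). r ^ card S * c S * walsh S x) ^ 4) =
        cube_expectation n (\<lambda>x. ?A x ^ 4 + 2 * ((?A x)\<^sup>2 * (?B x)\<^sup>2) + ?B x ^ 4 / 9
          + spin v x * (4 * r * ?A x ^ 3 * ?B x + 4 / 3 * r * ?A x * ?B x ^ 3))"
      unfolding expand by (intro cube_expectation_cong quartic spin_square[OF _ vn])
    also have "\<dots> = cube_expectation n (\<lambda>x. ?A x ^ 4) + 2 * cube_expectation n (\<lambda>x. (?A x)\<^sup>2 * (?B x)\<^sup>2)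
          + cube_expectation n (\<lambda>x. ?B x ^ 4) / 9
          + cube_expectation n (\<lambda>x. spin v x * (4 * r * ?A x ^ 3 * ?B x + 4 / 3 * r * ?A x * ?B x ^ 3))"
      by simp
    also have "cube_expectation n (\<lambda>x. spin v x * (4 * r * ?A x ^ 3 * ?B x + 4 / 3 * r * ?A x * ?B x ^ 3)) = 0"
      by (intro cube_expectation_odd[OF vn]) (simp only: Aflip Bflip spin_flip[OF _ vn], simp)
    finally have eq: "cube_expectation n (\<lambda>x. (\<Sum>S\<in>Pow (insert v V). r ^ card S * c S * walsh S x) ^ 4) =
        cube_expectation n (\<lambda>x. ?A x ^ 4) + 2 * cube_expectation n (\<lambda>x. (?A x)\<^sup>2 * (?B x)\<^sup>2)
          + cube_expectation n (\<lambda>x. ?B x ^ 4) / 9" by simp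
    have A4: "cube_expectation n (\<lambda>x. ?A x ^ 4) \<le> a\<^sup>2" unfolding a_def by (rule insert.IH[OF Vn])
    have B4: "cube_expectation n (\<lambda>x. ?B x ^ 4) \<le> b\<^sup>2" unfolding b_def by (rule insert.IH[OF Vn])
    have B0: "0 \<le> cube_expectation n (\<lambda>x. ?B x ^ 4)" by (intro cube_expectation_nonneg) simp
    have ab: "0 \<le> a" "0 \<le> b" unfolding a_def b_def by (simp_all add: sum_nonneg)
    have "(cube_expectation n (\<lambda>x. (?A x)\<^sup>2 * (?B x)\<^sup>2))\<^sup>2 \<le>
        cube_expectation n (\<lambda>x. ?A x ^ 4) * cube_expectation n (\<lambda>x. ?B x ^ 4)"
      using cube_expectation_Cauchy_Schwarz[of n "\<lambda>x. (?A x)\<^sup>2" "\<lambda>x. (?B x)\<^sup>2"]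
      by (simp flip: power_mult)
    also have "\<dots> \<le> a\<^sup>2 * b\<^sup>2" by (intro mult_mono A4 B4 B0) simp
    finally have "cube_expectation n (\<lambda>x. (?A x)\<^sup>2 * (?B x)\<^sup>2) \<le> a * b"
      by (rule power2_le_imp_le[OF _ mult_nonneg_nonneg[OF ab], unfolded power_mult_distrib])
    with eq A4 B4 B0 have "cube_expectation n (\<lambda>x. (\<Sum>S\<in>Pow (insert v V). r ^ card S * c S * walsh S x) ^ 4)
        \<le> a\<^sup>2 + 2 * (a * b) + b\<^sup>2" by linarith
    also have "\<dots> = (\<Sum>S\<in>Pow (insert v V). (c S)\<^sup>2)\<^sup>2"
      unfolding split a_def b_def by (simp add: power2_sum)
    finally show ?case .
  qed
qed

section \<open>Level weights of monotone functions\<close>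

text \<open>Monotonicity fixes the sign of the change under a flip: it is the sign of the
  spin.\<close>

lemma monotone_diff_flip:
  assumes "cube_monotone n f" "x \<in> cube n" "j \<in> {1..n}"
  shows "(f x - f (flip j x)) * spin j x = \<bar>f (flip j x) - f x\<bar>"
proof -
  have mono: "f y \<le> f z" if "y \<in> cube n" "z \<in> cube n" "\<And>i. i \<in> {1..n} \<Longrightarrow> y i \<le> z i" for y z
    using monotone_onD[OF assms(1)[unfolded cube_monotone_def] that(1,2)] that(3) by blast
  have flip: "flip j x \<in> cube n" using assms by simp
  from cube_values[OF assms(2,3)] show ?thesis
  proof
    assume "x j = 0"
    moreover from this have "f x \<le> f (flip j x)"
      using mono[OF assms(2) flip] by (simp add: flip_def)
    ultimately show ?thesis by (simp add: spin_def)
  next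
    assume "x j = 1"
    moreover from this have "f (flip j x) \<le> f x"
      using mono[OF flip assms(2)] by (simp add: flip_def)
    ultimately show ?thesis by (simp add: spin_def)
  qed
qed

lemma cube_expectation_mult_spin:
  assumes "j \<in> {1..n}"
  shows "2 * cube_expectation n (\<lambda>x. f x * spin j x) =
    cube_expectation n (\<lambda>x. (f x - f (flip j x)) * spin j x)"
proof -
  have "cube_expectation n (\<lambda>x. f x * spin j x) = cube_expectation n (\<lambda>x. f (flip j x) * spin j (flip j x))"
    using cube_expectation_flip[OF assms, of "\<lambda>x. f x * spin j x"] by simp
  also have "\<dots> = cube_expectation n (\<lambda>x. - (f (flip j x) * spin j x))"
    by (intro cube_expectation_cong) (simp only: spin_flip[OF _ assms], simp)
  finally show ?thesis by (simp add: left_diff_distrib)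
qed

text \<open>Pairing \<open>x\<close> with \<open>flip j x\<close> makes the influence linear in
  \<open>f\<close>: it is twice a Walsh coefficient of degree one. Sums of influences thus become
  correlations with sums of spins.\<close>

lemma influence_eq:
  assumes "cube_monotone n f" "j \<in> {1..n}"
  shows "influence n j f = 2 * cube_expectation n (\<lambda>x. f x * spin j x)"
  unfolding cube_expectation_mult_spin[OF assms(2)] influence_def
  using monotone_diff_flip[OF assms(1) _ assms(2)] by (intro cube_expectation_cong) simp

section \<open>Restriction to a block of coordinates\<close>

definition mix :: "nat set \<Rightarrow> (nat \<Rightarrow> nat) \<Rightarrow> (nat \<Rightarrow> nat) \<Rightarrow> (nat \<Rightarrow> nat)" where
  "mix I z x = (\<lambda>j. if j \<in> I then z j else x j)"

lemma mix_in_cube: "x \<in> cube n \<Longrightarrow> z \<in> cube n \<Longrightarrow> mix I z x \<in> cube n"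
  unfolding cube_def mix_def by (auto simp: PiE_iff extensional_def)

lemma mix_mix: "mix I (mix I x z) (mix I z x) = x"
  by (auto simp: mix_def)

text \<open>The map \<open>?h\<close> exchanges the coordinates in \<open>I\<close> between two
  points. It is an involution of the pairs, so a mixture of two independent uniform points is again
  uniform.\<close>

lemma cube_expectation_mix:
  "cube_expectation n (\<lambda>x. cube_expectation n (\<lambda>z. g (mix I z x))) = cube_expectation n g"
proof -
  let ?h = "\<lambda>(x, z). (mix I z x, mix I x z)"
  have bij: "bij_betw ?h (cube n \<times> cube n) (cube n \<times> cube n)"
    by (intro bij_betwI[where g = ?h]) (auto simp: mix_in_cube mix_mix)
  have "(\<Sum>x\<in>cube n. \<Sum>z\<in>cube n. g (mix I z x)) = (\<Sum>p\<in>cube n \<times> cube n. g (fst (?h p)))"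
    by (simp add: sum.cartesian_product case_prod_beta)
  also have "\<dots> = (\<Sum>p\<in>cube n \<times> cube n. g (fst p))"
    by (rule sum.reindex_bij_betw[OF bij])
  also have "\<dots> = 2 ^ n * (\<Sum>x\<in>cube n. g x)"
    using sum.cartesian_product[of "\<lambda>x _. g x" "cube n" "cube n"]
    by (simp add: case_prod_unfold card_cube sum_distrib_left)
  finally show ?thesis
    by (simp add: cube_expectation_eq_sum flip: sum_divide_distrib)
qed

text \<open>The degree-one Walsh coefficient at \<open>i\<close> of \<open>f\<close> restricted to
  the coordinates in \<open>I\<close>, the other coordinates being those of \<open>x\<close>.
  Resampling from the whole cube keeps all expectations on the same space.\<close>

definition fibre_coeff :: "nat \<Rightarrow> ((nat \<Rightarrow> nat) \<Rightarrow> real) \<Rightarrow> nat set \<Rightarrow> nat \<Rightarrow> (nat \<Rightarrow> nat) \<Rightarrow> real" where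
  "fibre_coeff n f I i x = cube_expectation n (\<lambda>z. f (mix I z x) * spin i z)"

text \<open>A restriction of a monotone function is monotone, so this is half an influence of the
  restriction. The sign is what permits multiplying the truncation inequality in
  \<open>fibre_weight_bound\<close> by this function.\<close>

lemma fibre_coeff_nonneg:
  assumes "cube_monotone n f" "i \<in> I" "i \<in> {1..n}" "x \<in> cube n"
  shows "0 \<le> fibre_coeff n f I i x"
proof -
  have "0 \<le> (f (mix I z x) - f (mix I (flip i z) x)) * spin i z" if z: "z \<in> cube n" for z
  proof -
    have "mix I (flip i z) x = flip i (mix I z x)" "spin i z = spin i (mix I z x)"
      using assms(2) by (auto simp: mix_def flip_def spin_def)
    then show ?thesis
      using monotone_diff_flip[OF assms(1) mix_in_cube[OF assms(4) z] assms(3)] by simp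
  qed
  then have "0 \<le> 2 * fibre_coeff n f I i x"
    unfolding fibre_coeff_def cube_expectation_mult_spin[OF assms(3)]
    by (intro cube_expectation_nonneg)
  then show ?thesis by simp
qed

text \<open>Bessel's inequality for the restricted function, applied to the singletons in
  \<open>I\<close>.\<close>

lemma fibre_coeff_bessel:
  assumes "f \<in> cube n \<rightarrow> {0..1}" "I \<subseteq> {1..n}" "x \<in> cube n"
  shows "(\<Sum>i\<in>I. (fibre_coeff n f I i x)\<^sup>2) \<le> 1"
proof -
  have f01: "(f y)\<^sup>2 \<le> 1" if "y \<in> cube n" for y
    using assms(1) that by (intro power_le_one) auto
  have "(\<Sum>i\<in>I. (fibre_coeff n f I i x)\<^sup>2) =
      (\<Sum>S\<in>(\<lambda>i. {i}) ` I. (walsh_coeff n (\<lambda>z. f (mix I z x)) S)\<^sup>2)"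
    by (simp add: sum.reindex walsh_coeff_def fibre_coeff_def walsh_def)
  also have "\<dots> \<le> cube_expectation n (\<lambda>z. (f (mix I z x))\<^sup>2)"
    using assms(2) by (intro walsh_bessel) auto
  also have "\<dots> \<le> cube_expectation n (\<lambda>_. 1)"
    by (intro cube_expectation_mono f01 mix_in_cube assms(3))
  finally show ?thesis by simp
qed

text \<open>As \<open>S\<close> avoids \<open>I\<close>, the factor \<open>walsh S x\<close> reads
  only coordinates kept from \<open>x\<close>. Together with the spin at \<open>i\<close> it is a
  Walsh function of the mixed point, which is uniform.\<close>

lemma walsh_coeff_fibre_coeff:
  assumes "i \<in> I" "S \<inter> I = {}" "finite S"
  shows "walsh_coeff n (fibre_coeff n f I i) S = walsh_coeff n f (insert i S)"
proof -
  have "walsh_coeff n (fibre_coeff n f I i) S =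
      cube_expectation n (\<lambda>x. cube_expectation n (\<lambda>z. f (mix I z x) * spin i z * walsh S x))"
    by (simp add: walsh_coeff_def fibre_coeff_def)
  also have "\<dots> = cube_expectation n (\<lambda>x. cube_expectation n (\<lambda>z.
      f (mix I z x) * walsh (insert i S) (mix I z x)))"
  proof -
    have "walsh S (mix I z x) = walsh S x" "spin i (mix I z x) = spin i z" for x z
      using assms(1,2) by (auto simp: walsh_def spin_def mix_def intro!: prod.cong)
    moreover have "i \<notin> S" using assms by blast
    ultimately show ?thesis using assms(3) by (simp add: walsh_insert mult.assoc)
  qed
  also have "\<dots> = walsh_coeff n f (insert i S)"
    unfolding walsh_coeff_def by (rule cube_expectation_mix)
  finally show ?thesis .
qed

text \<open>The weight \<open>w\<close> is the correlation of \<open>?F\<close> with its noised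
  version \<open>P\<close>. Where \<open>P\<close> is at most of order \<open>t * sqrt w\<close>, it
  is paid for by the mean of \<open>?F\<close>, half the influence; the excess is controlled by the
  fourth moment of \<open>P\<close>.\<close>

lemma fibre_weight_bound:
  assumes mono: "cube_monotone n f" and i: "i \<in> I" and I: "I \<subseteq> {1..n}" and t: "0 < t"
  defines "w \<equiv> (\<Sum>S\<in>Pow ({1..n} - I). (1/3) ^ card S * (walsh_coeff n f (insert i S))\<^sup>2)"
  shows "w \<le> t / 2 * (sqrt w * influence n i f) + cube_expectation n (\<lambda>x. (fibre_coeff n f I i x)\<^sup>2) / t"
    (is "_ \<le> _ + cube_expectation n (\<lambda>x. (?F x)\<^sup>2) / t")
proof -
  define J where "J = {1..n} - I"
  define r :: real where "r = sqrt (1/3)"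
  have r2: "r\<^sup>2 = 1/3" by (simp add: r_def)
  \<comment> \<open>The noise factor \<open>r ^ card S\<close> occurs twice. One copy is consumed by
    \<open>bonami\<close>; the other stays in the coefficients, whose squares then sum to
    \<open>w\<close>.\<close>
  define P where "P x = (\<Sum>S\<in>Pow J. r ^ card S * (r ^ card S * walsh_coeff n f (insert i S)) * walsh S x)" for x
  have Jn: "J \<subseteq> {1..n}" by (auto simp: J_def)
  have in_n: "i \<in> {1..n}" using i I by blast
  have rr: "r ^ k * r ^ k = (1/3) ^ k" for k
    by (metis r2 power2_eq_square power_mult_distrib)
  have coeff: "walsh_coeff n ?F S = walsh_coeff n f (insert i S)" if "S \<in> Pow J" for S
    using that finite_subset[of S "{1..n}"] by (intro walsh_coeff_fibre_coeff i) (auto simp: J_def)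
  have w_eq: "w = (\<Sum>S\<in>Pow J. (1/3) ^ card S * (walsh_coeff n f (insert i S))\<^sup>2)"
    by (simp add: w_def J_def)
  have w_nonneg: "0 \<le> w" unfolding w_eq by (intro sum_nonneg) simp
  have infl: "cube_expectation n ?F = influence n i f / 2"
    using coeff[of "{}"] influence_eq[OF mono in_n] by (simp add: walsh_coeff_def walsh_def)
  have FP: "cube_expectation n (\<lambda>x. ?F x * P x) = w"
  proof -
    have "cube_expectation n (\<lambda>x. ?F x * P x) =
        cube_expectation n (\<lambda>x. \<Sum>S\<in>Pow J. (1/3) ^ card S * walsh_coeff n f (insert i S) * (?F x * walsh S x))"
      unfolding P_def sum_distrib_left rr[symmetric] by (simp add: mult_ac)
    also have "\<dots> = (\<Sum>S\<in>Pow J. (1/3) ^ card S * walsh_coeff n f (insert i S) * walsh_coeff n ?F S)"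
      by (simp add: walsh_coeff_def)
    also have "\<dots> = w" unfolding w_eq
      by (intro sum.cong refl) (simp add: coeff power2_eq_square)
    finally show ?thesis .
  qed
  have P4: "cube_expectation n (\<lambda>x. P x ^ 4) \<le> w\<^sup>2"
    using bonami[OF Jn r2, of "\<lambda>S. r ^ card S * walsh_coeff n f (insert i S)"]
    unfolding P_def w_eq by (simp add: power_mult_distrib power2_eq_square[of "r ^ _"] rr)
  have w_le: "w \<le> cube_expectation n (\<lambda>x. (?F x)\<^sup>2)"
  proof -
    have "w \<le> (\<Sum>S\<in>Pow J. (walsh_coeff n ?F S)\<^sup>2)"
      unfolding w_eq by (intro sum_mono) (simp add: coeff mult_left_le_one_le power_le_one)
    also have "\<dots> \<le> cube_expectation n (\<lambda>x. (?F x)\<^sup>2)"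
      using Jn by (intro walsh_bessel) auto
    finally show ?thesis .
  qed
  show ?thesis
  proof (cases "w = 0")
    case True
    then show ?thesis using t by (simp add: cube_expectation_nonneg)
  next
    case False
    with w_nonneg have w: "0 < w" by simp
    define \<tau> where "\<tau> = t * sqrt w"
    have \<tau>: "0 < \<tau>" "\<tau>\<^sup>2 = t\<^sup>2 * w" using t w by (simp_all add: \<tau>_def power_mult_distrib)
    have "?F x * P x \<le> \<tau> * ?F x + ((?F x)\<^sup>2 / (2 * t) + P x ^ 4 / (2 * t * w))" if x: "x \<in> cube n" for x
    proof -
      \<comment> \<open>A smooth form of truncation at \<open>\<tau>\<close>: where \<open>P\<close>
        exceeds \<open>\<tau>\<close>, it is at most its square divided by
        \<open>\<tau>\<close>.\<close>
      have "P x * \<tau> \<le> \<tau>\<^sup>2 + (P x)\<^sup>2"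
        using sum_squares_bound[of \<tau> "P x"] sum_power2_ge_zero[of \<tau> "P x"] mult.commute[of "P x" \<tau>]
        by linarith
      then have "P x \<le> \<tau> + (P x)\<^sup>2 / \<tau>"
        using \<tau>(1) by (simp add: field_simps power2_eq_square)
      then have "?F x * P x \<le> ?F x * (\<tau> + (P x)\<^sup>2 / \<tau>)"
        using fibre_coeff_nonneg[OF mono i in_n x] by (rule mult_left_mono)
      also have "\<dots> = \<tau> * ?F x + ?F x * ((P x)\<^sup>2 / \<tau>)" by (simp add: algebra_simps)
      also have "?F x * ((P x)\<^sup>2 / \<tau>) \<le> (?F x)\<^sup>2 / (2 * t) + P x ^ 4 / (2 * t * w)"
      proof -
        \<comment> \<open>The weight \<open>t\<close> balances the two squares: since the fourth
          moment of \<open>P\<close> is at most the square of \<open>w\<close>, and \<open>w\<close>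
          is at most the second moment of \<open>?F\<close>, both contribute at most that moment
          over \<open>2 * t\<close>.\<close>
        have "2 * ?F x * (t * ((P x)\<^sup>2 / \<tau>)) \<le> (?F x)\<^sup>2 + (t * ((P x)\<^sup>2 / \<tau>))\<^sup>2"
          by (rule sum_squares_bound)
        also have "(t * ((P x)\<^sup>2 / \<tau>))\<^sup>2 = P x ^ 4 / w"
          using t by (simp add: power_mult_distrib power_divide \<tau>(2) flip: power_mult)
        finally have "2 * t * (?F x * ((P x)\<^sup>2 / \<tau>)) \<le> (?F x)\<^sup>2 + P x ^ 4 / w"
          by (simp add: mult_ac)
        then have "?F x * ((P x)\<^sup>2 / \<tau>) \<le> ((?F x)\<^sup>2 + P x ^ 4 / w) / (2 * t)"
          using t by (simp add: pos_le_divide_eq mult_ac)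
        then show ?thesis by (simp add: add_divide_distrib mult_ac)
      qed
      finally show ?thesis by simp
    qed
    then have "w \<le> cube_expectation n (\<lambda>x. \<tau> * ?F x + ((?F x)\<^sup>2 / (2 * t) + P x ^ 4 / (2 * t * w)))"
      unfolding FP[symmetric] by (intro cube_expectation_mono)
    also have "\<dots> = \<tau> * (influence n i f / 2) + cube_expectation n (\<lambda>x. (?F x)\<^sup>2) / (2 * t)
        + cube_expectation n (\<lambda>x. P x ^ 4) / (2 * t * w)"
      by (simp add: infl)
    also have "cube_expectation n (\<lambda>x. P x ^ 4) / (2 * t * w) \<le> w\<^sup>2 / (2 * t * w)"
      using t w by (intro divide_right_mono P4) simp
    also have "w\<^sup>2 / (2 * t * w) = w / (2 * t)" using w by (simp add: power2_eq_square)
    also have "w / (2 * t) \<le> cube_expectation n (\<lambda>x. (?F x)\<^sup>2) / (2 * t)"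
      using t by (intro divide_right_mono w_le) simp
    finally show ?thesis by (simp add: \<tau>_def field_simps)
  qed
qed

text \<open>Summing the bounds for single coordinates, Cauchy-Schwarz separates the weights from the
  influences. Bessel's inequality, over singletons and over sets outside \<open>I\<close>, bounds
  the total weight and the total second moment by 1.\<close>

lemma restricted_weight_bound:
  assumes f: "f \<in> cube n \<rightarrow> {0..1}" and mono: "cube_monotone n f" and I: "I \<subseteq> {1..n}" and t: "0 < t"
  shows "(\<Sum>i\<in>I. \<Sum>S\<in>Pow ({1..n} - I). (1/3) ^ card S * (walsh_coeff n f (insert i S))\<^sup>2)
    \<le> t * sqrt (sum_sq_influences n f) + 1 / t"
proof -
  define w where "w i = (\<Sum>S\<in>Pow ({1..n} - I). (1/3) ^ card S * (walsh_coeff n f (insert i S))\<^sup>2)" for i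
  let ?F = "fibre_coeff n f I"
  let ?II = "sum_sq_influences n f"
  have w_nonneg: "0 \<le> w i" for i unfolding w_def by (intro sum_nonneg) simp
  have infl_nonneg: "0 \<le> influence n i f" for i
    unfolding influence_def by (intro cube_expectation_nonneg) simp
  have II_nonneg: "0 \<le> ?II" by (simp add: sum_sq_influences_def sum_nonneg)
  have "(\<Sum>i\<in>I. cube_expectation n (\<lambda>x. (?F i x)\<^sup>2)) = cube_expectation n (\<lambda>x. \<Sum>i\<in>I. (?F i x)\<^sup>2)"
    by simp
  also have "\<dots> \<le> cube_expectation n (\<lambda>_. 1)"
    by (intro cube_expectation_mono fibre_coeff_bessel[OF f I])
  finally have F1: "(\<Sum>i\<in>I. cube_expectation n (\<lambda>x. (?F i x)\<^sup>2)) \<le> 1" by simp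
  have "(\<Sum>i\<in>I. w i) \<le> (\<Sum>i\<in>I. t / 2 * (sqrt (w i) * influence n i f) + cube_expectation n (\<lambda>x. (?F i x)\<^sup>2) / t)"
    unfolding w_def by (intro sum_mono fibre_weight_bound[OF mono _ I t])
  also have "\<dots> = t / 2 * (\<Sum>i\<in>I. sqrt (w i) * influence n i f)
      + (\<Sum>i\<in>I. cube_expectation n (\<lambda>x. (?F i x)\<^sup>2)) / t"
    by (simp only: sum.distrib sum_distrib_left sum_divide_distrib)
  also have "\<dots> \<le> t / 2 * sqrt ((\<Sum>i\<in>I. w i) * ?II) + 1 / t"
  proof (intro add_mono mult_left_mono divide_right_mono F1)
    have "(\<Sum>i\<in>I. sqrt (w i) * influence n i f)\<^sup>2 \<le> (\<Sum>i\<in>I. (sqrt (w i))\<^sup>2) * (\<Sum>i\<in>I. (influence n i f)\<^sup>2)"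
      by (rule Cauchy_Schwarz_ineq_sum)
    also have "\<dots> \<le> (\<Sum>i\<in>I. w i) * ?II"
      unfolding sum_sq_influences_def using w_nonneg I
      by (intro mult_mono sum_mono2 sum_nonneg) auto
    finally show "(\<Sum>i\<in>I. sqrt (w i) * influence n i f) \<le> sqrt ((\<Sum>i\<in>I. w i) * ?II)"
      by (rule real_le_rsqrt)
  qed (use t in simp_all)
  finally have main: "(\<Sum>i\<in>I. w i) \<le> t / 2 * sqrt ((\<Sum>i\<in>I. w i) * ?II) + 1 / t" .
  have w1: "(\<Sum>i\<in>I. w i) \<le> 1"
  proof -
    have "w i \<le> cube_expectation n (\<lambda>x. (?F i x)\<^sup>2)" if i: "i \<in> I" for i
    proof -
      have "w i \<le> (\<Sum>S\<in>Pow ({1..n} - I). (walsh_coeff n (?F i) S)\<^sup>2)"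
        unfolding w_def
      proof (intro sum_mono)
        fix S assume "S \<in> Pow ({1..n} - I)"
        then have "walsh_coeff n (?F i) S = walsh_coeff n f (insert i S)"
          using finite_subset[of S "{1..n}"] by (intro walsh_coeff_fibre_coeff i) auto
        then show "(1/3) ^ card S * (walsh_coeff n f (insert i S))\<^sup>2 \<le> (walsh_coeff n (?F i) S)\<^sup>2"
          by (simp add: mult_left_le_one_le power_le_one)
      qed
      also have "\<dots> \<le> cube_expectation n (\<lambda>x. (?F i x)\<^sup>2)" by (intro walsh_bessel) auto
      finally show ?thesis .
    qed
    then show ?thesis by (rule order_trans[OF sum_mono F1])
  qed
  have "sqrt ((\<Sum>i\<in>I. w i) * ?II) \<le> sqrt ?II"
    using mult_right_mono[OF w1 II_nonneg] by simp
  then have "t / 2 * sqrt ((\<Sum>i\<in>I. w i) * ?II) \<le> t * sqrt ?II"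
    using t by (intro mult_mono real_sqrt_ge_zero mult_nonneg_nonneg sum_nonneg w_nonneg II_nonneg) auto
  with main show ?thesis unfolding w_def by linarith
qed

section \<open>Averaging over the blocks\<close>

text \<open>For nonempty \<open>S\<close> and any \<open>R\<close> disjoint from it, the block
  \<open>insert (Min S) R\<close> meets \<open>S\<close> in \<open>Min S\<close> only. This produces
  each \<open>S\<close> once for every such \<open>R\<close>. Fixing the minimum as the common point
  makes the assignment injective and gives up a factor \<open>card S\<close>.\<close>

lemma sum_over_splittings_ge:
  fixes g :: "nat set \<Rightarrow> real"
  assumes V: "finite V" and g: "\<And>S. 0 \<le> g S"
  shows "(\<Sum>S\<in>Pow V - {{}}. 2 ^ card (V - S) * g S)
    \<le> (\<Sum>I\<in>Pow V. \<Sum>i\<in>I. \<Sum>S\<in>Pow (V - I). g (insert i S))"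
proof -
  let ?Y = "SIGMA S : Pow V - {{}}. Pow (V - S)"
  let ?X = "SIGMA I : Pow V. I \<times> Pow (V - I)"
  let ?h = "\<lambda>(S, R). (insert (Min S) R, Min S, S - {Min S})"
  have MinS: "Min S \<in> S" if "S \<in> Pow V - {{}}" for S
    using that V finite_subset[of S V] by (intro Min_in) auto
  have finI: "finite I" if "I \<in> Pow V" for I using that V finite_subset by auto
  have inj: "inj_on ?h ?Y"
  proof (rule inj_on_inverseI[where g = "\<lambda>(I, i, S). (insert i S, I - {i})"])
    fix p assume "p \<in> ?Y"
    then obtain S R where "p = (S, R)" "S \<in> Pow V - {{}}" "R \<in> Pow (V - S)" by auto
    with MinS[of S] show "(\<lambda>(I, i, S). (insert i S, I - {i})) (?h p) = p" by auto
  qed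
  have sub: "?h ` ?Y \<subseteq> ?X"
  proof
    fix q assume "q \<in> ?h ` ?Y"
    then obtain S R where "q = ?h (S, R)" "S \<in> Pow V - {{}}" "R \<in> Pow (V - S)" by auto
    with MinS[of S] show "q \<in> ?X" by auto
  qed
  have finX: "finite ?X"
    using V finI by (intro finite_SigmaI finite_cartesian_product) auto
  have "(\<Sum>S\<in>Pow V - {{}}. 2 ^ card (V - S) * g S) = (\<Sum>S\<in>Pow V - {{}}. \<Sum>R\<in>Pow (V - S). g S)"
    using V by (simp add: card_Pow)
  also have "\<dots> = (\<Sum>(S, R)\<in>?Y. g S)"
    using V by (intro sum.Sigma) auto
  also have "\<dots> = (\<Sum>p\<in>?Y. (\<lambda>(I, i, S). g (insert i S)) (?h p))"
  proof (intro sum.cong refl)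
    fix p assume "p \<in> ?Y"
    then obtain S R where "p = (S, R)" "S \<in> Pow V - {{}}" by auto
    with MinS[of S] show "(case p of (S, R) \<Rightarrow> g S) = (\<lambda>(I, i, S). g (insert i S)) (?h p)"
      by (simp add: insert_absorb)
  qed
  also have "\<dots> = (\<Sum>(I, i, S)\<in>?h ` ?Y. g (insert i S))"
    unfolding sum.reindex[OF inj] o_def ..
  also have "\<dots> \<le> (\<Sum>(I, i, S)\<in>?X. g (insert i S))"
    by (rule sum_mono2[OF finX sub]) (auto simp: g)
  also have "\<dots> = (\<Sum>I\<in>Pow V. \<Sum>(i, S)\<in>I \<times> Pow (V - I). g (insert i S))"
    using V finI by (intro sum.Sigma[symmetric]) auto
  also have "\<dots> = (\<Sum>I\<in>Pow V. \<Sum>i\<in>I. \<Sum>S\<in>Pow (V - I). g (insert i S))"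
    unfolding sum.cartesian_product ..
  finally show ?thesis .
qed

text \<open>A uniformly random block meets a nonempty \<open>S\<close> in its minimum alone with
  probability 2 to the power \<open>- card S\<close>. This loss turns the factor 1/3 of the
  hypercontractive bound into 1/6.\<close>

lemma noisy_weight_bound:
  assumes f: "f \<in> cube n \<rightarrow> {0..1}" and mono: "cube_monotone n f" and t: "0 < t"
  shows "(\<Sum>S\<in>Pow {1..n} - {{}}. (1/6) ^ card S * (walsh_coeff n f S)\<^sup>2)
    \<le> t * sqrt (sum_sq_influences n f) + 1 / t"
proof -
  let ?V = "{1..n}"
  let ?Q = "t * sqrt (sum_sq_influences n f) + 1 / t"
  \<comment> \<open>The exponent drops the point common to \<open>S\<close> and the block, so
    \<open>g (insert i S)\<close> carries the exponent \<open>card S\<close>. The truncated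
    subtraction at the empty set is harmless, as only nonempty sets are summed.\<close>
  define g where "g S = (1/3) ^ (card S - 1) * (walsh_coeff n f S)\<^sup>2" for S
  have "2 ^ n * (\<Sum>S\<in>Pow ?V - {{}}. (1/6) ^ card S * (walsh_coeff n f S)\<^sup>2)
      \<le> (\<Sum>S\<in>Pow ?V - {{}}. 2 ^ card (?V - S) * g S)"
    unfolding sum_distrib_left
  proof (intro sum_mono)
    fix S assume S: "S \<in> Pow ?V - {{}}"
    then have fS: "finite S" using finite_subset by blast
    have le: "card S \<le> n" using S card_mono[of ?V S] by auto
    have "(2::real) ^ n * (1/6) ^ card S = 2 ^ (n - card S) * (2 ^ card S * (1/6) ^ card S)"
      using le power_add[of "2::real" "n - card S" "card S"] by simp
    also have "(2::real) ^ card S * (1/6) ^ card S = (1/3) ^ card S"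
      unfolding power_mult_distrib[symmetric] by simp
    also have "(1/3::real) ^ card S \<le> (1/3) ^ (card S - 1)" by (intro power_decreasing) auto
    also have "n - card S = card (?V - S)"
      using S fS by (subst card_Diff_subset) auto
    finally have "(2::real) ^ n * (1/6) ^ card S \<le> 2 ^ card (?V - S) * (1/3) ^ (card S - 1)" by simp
    then show "2 ^ n * ((1/6) ^ card S * (walsh_coeff n f S)\<^sup>2) \<le> 2 ^ card (?V - S) * g S"
      unfolding g_def mult.assoc[symmetric] by (rule mult_right_mono) simp
  qed
  also have "\<dots> \<le> (\<Sum>I\<in>Pow ?V. \<Sum>i\<in>I. \<Sum>S\<in>Pow (?V - I). g (insert i S))"
    by (intro sum_over_splittings_ge) (auto simp: g_def)
  also have "\<dots> = (\<Sum>I\<in>Pow ?V. \<Sum>i\<in>I. \<Sum>S\<in>Pow (?V - I).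
      (1/3) ^ card S * (walsh_coeff n f (insert i S))\<^sup>2)"
  proof (intro sum.cong refl)
    fix I i S assume "I \<in> Pow ?V" "i \<in> I" "S \<in> Pow (?V - I)"
    then have "finite S" "i \<notin> S" using finite_subset[of S ?V] by auto
    then show "g (insert i S) = (1/3) ^ card S * (walsh_coeff n f (insert i S))\<^sup>2"
      by (simp add: g_def)
  qed
  also have "\<dots> \<le> (\<Sum>I\<in>Pow ?V. ?Q)"
    by (intro sum_mono restricted_weight_bound[OF f mono _ t]) simp
  also have "\<dots> = 2 ^ n * ?Q"
    by (simp only: sum_constant card_Pow finite_atLeastAtMost card_atLeastAtMost) simp
  finally show ?thesis by (rule mult_left_le_imp_le) simp
qed

section \<open>Majorities and influences\<close>

definition level :: "nat \<Rightarrow> nat set \<Rightarrow> nat \<Rightarrow> (nat \<Rightarrow> nat) set" where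
  "level n K k = {x \<in> cube n. (\<Sum>j\<in>K. x j) = k}"

lemma sum_spin: "finite K \<Longrightarrow> (\<Sum>j\<in>K. spin j x) = 2 * real (\<Sum>j\<in>K. x j) - real (card K)"
  by (simp only: spin_def sum_subtractf sum_distrib_left of_nat_sum sum_constant mult_1_right)

lemma card_ones:
  assumes "x \<in> cube n" "K \<subseteq> {1..n}"
  shows "card {j \<in> K. x j = 1} = (\<Sum>j\<in>K. x j)"
proof -
  have fin: "finite K" using assms(2) by (rule finite_subset) simp
  have "x j = 0 \<or> x j = 1" if "j \<in> K" for j
    using cube_values[OF assms(1)] assms(2) that by blast
  then have "(\<Sum>j\<in>K. x j) = (\<Sum>j\<in>K. if x j = 1 then 1 else 0)"
    by (intro sum.cong refl) fastforce
  also have "\<dots> = card {j \<in> K. x j = 1}"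
    using sum.inter_filter[OF fin, of "\<lambda>_. 1::nat" "\<lambda>j. x j = 1"] by simp
  finally show ?thesis by simp
qed

lemma card_zeros:
  assumes "x \<in> cube n" "K \<subseteq> {1..n}"
  shows "card {j \<in> K. x j = 0} = card K - (\<Sum>j\<in>K. x j)"
proof -
  have fin: "finite K" using assms(2) by (rule finite_subset) simp
  have "x j = 0 \<or> x j = 1" if "j \<in> K" for j
    using cube_values[OF assms(1)] assms(2) that by blast
  then have "{j \<in> K. x j = 0} = K - {j \<in> K. x j = 1}"
    by fastforce
  then show ?thesis
    using fin by (simp add: card_Diff_subset card_ones[OF assms] del: One_nat_def)
qed

lemma sum_flip:
  assumes "finite K" "j \<in> K"
  shows "x j = 0 \<Longrightarrow> (\<Sum>i\<in>K. flip j x i) = Suc (\<Sum>i\<in>K. x i)"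
    and "x j = 1 \<Longrightarrow> Suc (\<Sum>i\<in>K. flip j x i) = (\<Sum>i\<in>K. x i)"
  using assms by (simp_all add: sum.remove[of K j] flip_def)

text \<open>Both sides count edges of the cube between two consecutive levels.\<close>

lemma level_sum_step:
  assumes mono: "cube_monotone n f" and K: "K \<subseteq> {1..n}"
  shows "real (card K - k) * sum f (level n K k) \<le> real (Suc k) * sum f (level n K (Suc k))"
proof -
  let ?D = "SIGMA x : level n K k. {j \<in> K. x j = 0}"
  let ?U = "SIGMA y : level n K (Suc k). {j \<in> K. y j = 1}"
  have fin: "finite K" using K by (rule finite_subset) simp
  have finL: "finite (level n K l)" for l by (simp add: level_def)
  have "real (card K - k) * sum f (level n K k) = (\<Sum>x\<in>level n K k. \<Sum>j\<in>{j \<in> K. x j = 0}. f x)"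
    unfolding sum_distrib_left by (intro sum.cong refl) (simp add: level_def card_zeros[OF _ K])
  also have "\<dots> = (\<Sum>(x, j)\<in>?D. f x)"
    using fin finL by (intro sum.Sigma) auto
  also have "\<dots> \<le> (\<Sum>(x, j)\<in>?D. f (flip j x))"
  proof (rule sum_mono, clarify)
    fix x j assume xj: "x \<in> level n K k" "j \<in> K" "x j = 0"
    then have "x \<in> cube n" "j \<in> {1..n}" using K by (auto simp: level_def)
    from monotone_diff_flip[OF mono this] xj(3) show "f x \<le> f (flip j x)"
      by (simp add: spin_def)
  qed
  also have "\<dots> = (\<Sum>(y, j)\<in>?U. f y)"
  proof (rule sum.reindex_bij_witness[where i = "\<lambda>(y, j). (flip j y, j)" and j = "\<lambda>(x, j). (flip j x, j)"])
    fix p assume "p \<in> ?D"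
    then obtain x j where p: "p = (x, j)" and xj: "x \<in> cube n" "(\<Sum>i\<in>K. x i) = k" "j \<in> K" "x j = 0"
      by (auto simp: level_def)
    have j: "j \<in> {1..n}" using xj K by auto
    show "(case case p of (x, j) \<Rightarrow> (flip j x, j) of (y, j) \<Rightarrow> (flip j y, j)) = p"
      using flip_flip[OF xj(1) j] by (simp add: p)
    show "(case p of (x, j) \<Rightarrow> (flip j x, j)) \<in> ?U"
      using xj flip_in_cube[OF xj(1) j] sum_flip(1)[OF fin xj(3), of x, OF xj(4)] by (simp add: p level_def flip_def)
  next
    fix p assume "p \<in> ?U"
    then obtain x j where p: "p = (x, j)" and xj: "x \<in> cube n" "(\<Sum>i\<in>K. x i) = Suc k" "j \<in> K" "x j = 1"
      by (auto simp: level_def)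
    have j: "j \<in> {1..n}" using xj K by auto
    show "(case case p of (y, j) \<Rightarrow> (flip j y, j) of (x, j) \<Rightarrow> (flip j x, j)) = p"
      using flip_flip[OF xj(1) j] by (simp add: p)
    show "(case p of (y, j) \<Rightarrow> (flip j y, j)) \<in> ?D"
      using xj flip_in_cube[OF xj(1) j] sum_flip(2)[OF fin xj(3), of x, OF xj(4)] by (simp add: p level_def flip_def)
  qed auto
  also have "\<dots> = (\<Sum>y\<in>level n K (Suc k). \<Sum>j\<in>{j \<in> K. y j = 1}. f y)"
    using fin finL by (intro sum.Sigma[symmetric]) auto
  also have "\<dots> = real (Suc k) * sum f (level n K (Suc k))"
    unfolding sum_distrib_left by (intro sum.cong refl) (simp add: level_def card_ones[OF _ K] del: One_nat_def)
  finally show ?thesis .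
qed

text \<open>A level has the binomial coefficient times a power of 2 depending only on
  \<open>n - card K\<close> as its size, so these quotients are averages up to a common factor. The
  absorption identities for binomials turn the edge count into a comparison of consecutive
  averages.\<close>

lemma level_average_mono:
  assumes mono: "cube_monotone n f" and K: "K \<subseteq> {1..n}" and "k \<le> l" "l \<le> card K"
  shows "sum f (level n K k) / real (card K choose k) \<le> sum f (level n K l) / real (card K choose l)"
  using assms(3,4)
proof (induction l rule: dec_induct)
  case (step l)
  let ?m = "card K"
  have lt: "l < ?m" using step.prems by simp
  have pos: "0 < real (?m choose l)" "0 < real (?m choose Suc l)" using lt by (simp_all add: zero_less_binomial)
  have "Suc l * (?m choose Suc l) = (?m - l) * (?m choose l)"
    by (simp only: binomial_absorption binomial_absorb_comp)
  then have binom: "real (Suc l) * real (?m choose Suc l) = real (?m - l) * real (?m choose l)"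
    by (metis of_nat_mult)
  have "real (Suc l) * (real (?m choose Suc l) * sum f (level n K l)) =
      real (?m choose l) * (real (?m - l) * sum f (level n K l))"
    by (simp only: mult.assoc[symmetric] binom) (simp only: mult_ac)
  also have "\<dots> \<le> real (?m choose l) * (real (Suc l) * sum f (level n K (Suc l)))"
    using level_sum_step[OF mono K, of l] by (intro mult_left_mono) auto
  also have "\<dots> = real (Suc l) * (real (?m choose l) * sum f (level n K (Suc l)))"
    by (simp only: mult_ac)
  finally have "real (?m choose Suc l) * sum f (level n K l) \<le> real (?m choose l) * sum f (level n K (Suc l))"
    by (rule mult_left_le_imp_le) simp
  then have "sum f (level n K l) / real (?m choose l) \<le> sum f (level n K (Suc l)) / real (?m choose Suc l)"
    using pos by (simp add: divide_le_eq le_divide_eq mult_ac)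
  with step show ?case by simp
qed simp

text \<open>Opposite levels have equal size, so the comparison of averages is one of sums.\<close>

lemma level_sum_reflect:
  assumes "cube_monotone n f" "K \<subseteq> {1..n}" "2 * k \<le> card K"
  shows "sum f (level n K k) \<le> sum f (level n K (card K - k))"
proof -
  have k: "k \<le> card K" using assms(3) by simp
  have "sum f (level n K k) / real (card K choose k) \<le>
      sum f (level n K (card K - k)) / real (card K choose (card K - k))"
    using assms(3) by (intro level_average_mono assms(1,2)) auto
  then show ?thesis
    using k by (simp add: binomial_symmetric[symmetric, OF k] divide_le_cancel zero_less_binomial)
qed

text \<open>On the levels \<open>k\<close> and \<open>card K - k\<close> the sum of spins takes
  opposite values, so \<open>\<psi>\<close> does too, while the upper level carries the larger sum
  of \<open>f\<close>. Hence each pair contributes a nonnegative amount.\<close>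

lemma odd_function_of_sum_spin_nonneg:
  assumes mono: "cube_monotone n f" and K: "K \<subseteq> {1..n}"
    and odd: "\<And>u. \<psi> (- u) = - \<psi> u" and nonneg: "\<And>u. 0 \<le> u \<Longrightarrow> 0 \<le> \<psi> u"
  shows "0 \<le> cube_expectation n (\<lambda>x. f x * \<psi> (\<Sum>j\<in>K. spin j x))"
proof -
  let ?m = "card K"
  let ?a = "\<lambda>k. sum f (level n K k)"
  let ?g = "\<lambda>k. \<psi> (2 * real k - real ?m) * ?a k"
  have fin: "finite K" using K by (rule finite_subset) simp
  have le: "(\<Sum>j\<in>K. x j) \<le> ?m" if "x \<in> cube n" for x
    unfolding card_ones[OF that K, symmetric] using fin by (intro card_mono) auto
  have "(\<Sum>x\<in>cube n. f x * \<psi> (\<Sum>j\<in>K. spin j x)) =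
      (\<Sum>k\<in>{..?m}. \<Sum>x | x \<in> cube n \<and> (\<Sum>j\<in>K. x j) = k. f x * \<psi> (\<Sum>j\<in>K. spin j x))"
    using le by (intro sum.group[symmetric]) auto
  also have "\<dots> = (\<Sum>k\<in>{..?m}. ?g k)"
    unfolding sum_distrib_left level_def
    by (intro sum.cong refl) (simp add: sum_spin[OF fin] mult.commute flip: of_nat_sum)
  finally have eq: "(\<Sum>x\<in>cube n. f x * \<psi> (\<Sum>j\<in>K. spin j x)) = (\<Sum>k\<in>{..?m}. ?g k)" .
  have refl_term: "0 \<le> ?g k + ?g (?m - k)" if "k \<le> ?m" for k
  proof -
    have "\<psi> (2 * real (?m - k) - real ?m) = - \<psi> (2 * real k - real ?m)"
      using odd[of "2 * real k - real ?m"] that by (simp add: of_nat_diff algebra_simps)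
    then have sum_eq: "?g k + ?g (?m - k) = \<psi> (2 * real k - real ?m) * (?a k - ?a (?m - k))"
      by (simp add: algebra_simps)
    show ?thesis
    proof (cases "2 * k \<le> ?m")
      case True
      have "0 \<le> \<psi> (- (2 * real k - real ?m))" using True by (intro nonneg) simp
      then have "\<psi> (2 * real k - real ?m) \<le> 0" unfolding odd by simp
      then show ?thesis unfolding sum_eq
        using level_sum_reflect[OF mono K True] by (intro mult_nonpos_nonpos) auto
    next
      case False
      then have "0 \<le> \<psi> (2 * real k - real ?m)" by (intro nonneg) simp
      moreover have "?a (?m - k) \<le> ?a k"
        using level_sum_reflect[OF mono K, of "?m - k"] False that by simp
      ultimately show ?thesis unfolding sum_eq by simp
    qed
  qed
  \<comment> \<open>Adding the sum to its own reflection pairs the levels without treating a middle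
    level separately.\<close>
  have "(\<Sum>k\<in>{..?m}. ?g k) = (\<Sum>k\<in>{..?m}. ?g (?m - k))"
    by (rule sum.reindex_bij_witness[where i = "\<lambda>k. ?m - k" and j = "\<lambda>k. ?m - k"]) auto
  then have "2 * (\<Sum>k\<in>{..?m}. ?g k) = (\<Sum>k\<in>{..?m}. ?g k + ?g (?m - k))"
    by (simp add: sum.distrib)
  also have "0 \<le> \<dots>" by (intro sum_nonneg refl_term) simp
  finally show ?thesis unfolding cube_expectation_eq_sum eq by simp
qed

section \<open>Gaussian tails of sums of spins\<close>

lemma cosh_le_exp_square: "cosh l \<le> exp (l\<^sup>2 / 2)" for l :: real
proof -
  have *: "cosh l \<le> exp (l\<^sup>2 / 2)" if "0 \<le> l" for l :: real
  proof -
    have "exp (2 * l) = exp l * exp l" by (simp add: exp_double power2_eq_square)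
    then have "cosh l = exp (- l) * (1 + 1 / 2 * (exp (2 * l) - 1))"
      by (simp only: cosh_def exp_minus) (simp add: field_simps)
    also have "\<dots> = exp (- (2 * l) * (1 / 2) + ln (1 + 1 / 2 * (exp (2 * l) - 1)))"
    proof -
      have "0 < 1 + 1 / 2 * (exp (2 * l) - 1)"
        by (simp add: field_simps add_pos_pos)
      then show ?thesis unfolding exp_add by (simp only: exp_ln) simp
    qed
    \<comment> \<open>The analytic inequality behind Hoeffding's lemma, for a fair coin and an
      interval of length \<open>2 * l\<close>.\<close>
    also have "\<dots> \<le> exp ((2 * l)\<^sup>2 / 8)"
      using Hoeffdings_lemma_aux[of "2 * l" "1/2"] that by simp
    finally show ?thesis by (simp add: power2_eq_square)
  qed
  show ?thesis using *[of l] *[of "- l"] by (cases "0 \<le> l") auto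
qed

text \<open>Since a spin is a sign, \<open>exp (l * spin v x)\<close> equals
  \<open>cosh l + sinh l * spin v x\<close>. The second part averages to zero, so every coordinate
  contributes one factor \<open>cosh l\<close>.\<close>

lemma exp_moment_sum_spin:
  assumes "K \<subseteq> {1..n}"
  shows "cube_expectation n (\<lambda>x. exp (l * (\<Sum>j\<in>K. spin j x))) = cosh l ^ card K"
proof -
  have "finite K" using assms by (rule finite_subset) simp
  then show ?thesis using assms
  proof (induction K rule: finite_induct)
    case (insert v K)
    let ?g = "\<lambda>x. exp (l * (\<Sum>j\<in>K. spin j x))"
    have vn: "v \<in> {1..n}" using insert.prems by auto
    have "exp (l * (\<Sum>j\<in>insert v K. spin j x)) = cosh l * ?g x + sinh l * (spin v x * ?g x)"
      if x: "x \<in> cube n" for x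
    proof -
      have "exp (l * spin v x) = cosh l + sinh l * spin v x"
        using spin_cases[OF x vn] by (auto simp: cosh_plus_sinh cosh_minus_sinh)
      then show ?thesis using insert.hyps by (simp add: distrib_left exp_add algebra_simps)
    qed
    then have "cube_expectation n (\<lambda>x. exp (l * (\<Sum>j\<in>insert v K. spin j x))) =
        cube_expectation n (\<lambda>x. cosh l * ?g x + sinh l * (spin v x * ?g x))"
      by (rule cube_expectation_cong)
    also have "\<dots> = cosh l * cube_expectation n ?g + sinh l * cube_expectation n (\<lambda>x. spin v x * ?g x)"
      by simp
    also have "cube_expectation n (\<lambda>x. spin v x * ?g x) = 0"
    proof (rule cube_expectation_odd[OF vn])
      fix x assume x: "x \<in> cube n"
      have "(\<Sum>j\<in>K. spin j (flip v x)) = (\<Sum>j\<in>K. spin j x)"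
        using insert.hyps by (intro sum.cong) (auto simp: spin_flip[OF x vn])
      then show "spin v (flip v x) * ?g (flip v x) = - (spin v x * ?g x)"
        by (simp add: spin_flip[OF x vn])
    qed
    finally show ?case using insert by simp
  qed simp
qed

text \<open>Chernoff's method for the mean excess: the positive part of \<open>u\<close> is at most
  \<open>exp (l * u) / l\<close>.\<close>

lemma sum_spin_tail:
  assumes K: "K \<subseteq> {1..n}" and T: "0 < T" and m: "0 < card K"
  shows "cube_expectation n (\<lambda>x. max 0 (\<bar>\<Sum>j\<in>K. spin j x\<bar> - T))
    \<le> 2 * real (card K) / T * exp (- (T\<^sup>2) / (2 * real (card K)))"
proof -
  let ?S = "\<lambda>x. \<Sum>j\<in>K. spin j x"
  let ?m = "real (card K)"
  \<comment> \<open>This \<open>l\<close> minimises the exponent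
    \<open>- l * T + card K * l\<^sup>2 / 2\<close>.\<close>
  define l where "l = T / ?m"
  have l: "0 < l" using T m by (simp add: l_def)
  have "max 0 (\<bar>?S x\<bar> - T) \<le> exp (- (l * T)) / l * (exp (l * ?S x) + exp (- l * ?S x))" for x
  proof -
    have "max 0 (\<bar>?S x\<bar> - T) * l \<le> exp (l * (\<bar>?S x\<bar> - T))"
    proof (cases "\<bar>?S x\<bar> \<le> T")
      case False
      then have "max 0 (\<bar>?S x\<bar> - T) * l = l * (\<bar>?S x\<bar> - T)" by simp
      then show ?thesis using exp_ge_add_one_self[of "l * (\<bar>?S x\<bar> - T)"] by linarith
    qed simp
    also have "\<dots> = exp (- (l * T)) * exp (l * \<bar>?S x\<bar>)" by (simp add: algebra_simps flip: exp_add)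
    also have "exp (l * \<bar>?S x\<bar>) \<le> exp (l * ?S x) + exp (- l * ?S x)"
      by (cases "0 \<le> ?S x") auto
    finally have "max 0 (\<bar>?S x\<bar> - T) * l \<le> exp (- (l * T)) * (exp (l * ?S x) + exp (- l * ?S x))"
      by simp
    from mult_imp_le_div_pos[OF l this] show ?thesis by simp
  qed
  then have "cube_expectation n (\<lambda>x. max 0 (\<bar>?S x\<bar> - T)) \<le>
      cube_expectation n (\<lambda>x. exp (- (l * T)) / l * (exp (l * ?S x) + exp (- l * ?S x)))"
    by (rule cube_expectation_mono)
  also have "\<dots> = exp (- (l * T)) / l *
      (cube_expectation n (\<lambda>x. exp (l * ?S x)) + cube_expectation n (\<lambda>x. exp (- l * ?S x)))"
    by simp
  also have "\<dots> = exp (- (l * T)) / l * (2 * cosh l ^ card K)"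
    unfolding exp_moment_sum_spin[OF K] by simp
  also have "\<dots> \<le> exp (- (l * T)) / l * (2 * exp (l\<^sup>2 / 2) ^ card K)"
    using l by (intro mult_left_mono power_mono cosh_le_exp_square) (simp_all add: less_imp_le[OF cosh_real_pos])
  also have "\<dots> =
      2 / l * (exp (- (l * T)) * exp (?m * (l\<^sup>2 / 2)))"
    unfolding exp_of_nat_mult by simp
  also have "exp (- (l * T)) * exp (?m * (l\<^sup>2 / 2)) = exp (- (T\<^sup>2) / (2 * ?m))"
    using m by (simp add: l_def power2_eq_square field_simps flip: exp_add)
  also have "2 / l = 2 * ?m / T" by (simp add: l_def)
  finally show ?thesis .
qed

section \<open>From majority correlations to influences\<close>

lemma majority_eq: "majority K x = sgn (\<Sum>j\<in>K. spin j x)"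
  by (simp add: majority_def spin_def)

lemma abs_expectation_majority_le_Lam:
  assumes "K \<subseteq> {1..n}"
  shows "\<bar>cube_expectation n (\<lambda>x. f x * majority K x)\<bar> \<le> Lam n f"
  unfolding Lam_def using assms by (intro Max_ge) auto

lemma Lam_nonneg: "0 \<le> Lam n f"
  using abs_expectation_majority_le_Lam[of "{}" n f] by simp

lemma Lam_le_1:
  assumes "f \<in> cube n \<rightarrow> {0..1}"
  shows "Lam n f \<le> 1"
proof -
  have "\<bar>cube_expectation n (\<lambda>x. f x * majority K x)\<bar> \<le> 1" for K
  proof -
    have "\<bar>f x * majority K x\<bar> \<le> 1" if "x \<in> cube n" for x
    proof -
      have "0 \<le> f x" "f x \<le> 1" using assms that by auto
      then show ?thesis by (simp add: majority_eq sgn_real_def)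
    qed
    then have "cube_expectation n (\<lambda>x. f x * majority K x) \<le> cube_expectation n (\<lambda>_. 1)"
      "cube_expectation n (\<lambda>_. - 1) \<le> cube_expectation n (\<lambda>x. f x * majority K x)"
      by (intro cube_expectation_mono; force simp: abs_le_iff)+
    then show ?thesis by (simp add: abs_le_iff)
  qed
  then show ?thesis unfolding Lam_def by (subst Max_le_iff) auto
qed

text \<open>With \<open>S\<close> the sum of the spins, \<open>T sgn S - S\<close> is \<open>sgn S (T - |S|)\<^sub>+\<close>, which is odd in \<open>S\<close> and hence
  correlates nonnegatively with \<open>f\<close>, minus \<open>sgn S (|S| - T)\<^sub>+\<close>.\<close>

lemma expectation_sum_spin_le:
  assumes f: "f \<in> cube n \<rightarrow> {0..1}" and mono: "cube_monotone n f" and K: "K \<subseteq> {1..n}" and T: "0 \<le> T"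
  shows "cube_expectation n (\<lambda>x. f x * (\<Sum>j\<in>K. spin j x))
    \<le> T * Lam n f + cube_expectation n (\<lambda>x. max 0 (\<bar>\<Sum>j\<in>K. spin j x\<bar> - T))"
proof -
  let ?S = "\<lambda>x. \<Sum>j\<in>K. spin j x"
  define \<psi> where "\<psi> u = sgn u * max 0 (T - \<bar>u\<bar>)" for u :: real
  have \<psi>: "0 \<le> cube_expectation n (\<lambda>x. f x * \<psi> (?S x))"
    by (rule odd_function_of_sum_spin_nonneg[OF mono K]) (auto simp: \<psi>_def sgn_real_def)
  have "f x * ?S x \<le> (T * (f x * majority K x) - f x * \<psi> (?S x)) + max 0 (\<bar>?S x\<bar> - T)"
    if "x \<in> cube n" for x
  proof -
    have fx: "0 \<le> f x" "f x \<le> 1" using f that by auto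
    have "?S x - T * majority K x + \<psi> (?S x) = sgn (?S x) * max 0 (\<bar>?S x\<bar> - T)"
      using T by (auto simp: \<psi>_def majority_eq sgn_real_def max_def)
    also have "\<dots> \<le> max 0 (\<bar>?S x\<bar> - T)" by (auto simp: sgn_real_def)
    finally have "f x * (?S x - T * majority K x + \<psi> (?S x)) \<le> f x * max 0 (\<bar>?S x\<bar> - T)"
      using fx(1) by (rule mult_left_mono)
    also have "\<dots> \<le> max 0 (\<bar>?S x\<bar> - T)"
      using fx by (intro mult_left_le_one_le) auto
    finally show ?thesis by (simp add: algebra_simps)
  qed
  then have "cube_expectation n (\<lambda>x. f x * ?S x) \<le>
      cube_expectation n (\<lambda>x. (T * (f x * majority K x) - f x * \<psi> (?S x)) + max 0 (\<bar>?S x\<bar> - T))"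
    by (rule cube_expectation_mono)
  also have "\<dots> = T * cube_expectation n (\<lambda>x. f x * majority K x) - cube_expectation n (\<lambda>x. f x * \<psi> (?S x))
      + cube_expectation n (\<lambda>x. max 0 (\<bar>?S x\<bar> - T))"
    by simp
  also have "\<dots> \<le> T * Lam n f + cube_expectation n (\<lambda>x. max 0 (\<bar>?S x\<bar> - T))"
    using mult_left_mono[OF order_trans[OF abs_ge_self abs_expectation_majority_le_Lam[OF K, of f]] T] \<psi>
    by linarith
  finally show ?thesis .
qed

lemma sum_influences_le:
  assumes f: "f \<in> cube n \<rightarrow> {0..1}" and mono: "cube_monotone n f" and K: "K \<subseteq> {1..n}"
  shows "(\<Sum>j\<in>K. influence n j f) \<le> 4 * Lam n f * sqrt (2 * (1 - ln (Lam n f))) * sqrt (real (card K))"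
proof -
  let ?S = "\<lambda>x. \<Sum>j\<in>K. spin j x"
  let ?m = "real (card K)"
  let ?L = "Lam n f"
  have fin: "finite K" using K by (rule finite_subset) simp
  have "(\<Sum>j\<in>K. influence n j f) = (\<Sum>j\<in>K. 2 * cube_expectation n (\<lambda>x. f x * spin j x))"
    using K by (intro sum.cong refl influence_eq[OF mono]) auto
  also have "\<dots> = 2 * cube_expectation n (\<lambda>x. f x * ?S x)"
    by (simp add: sum_distrib_left)
  finally have infl: "(\<Sum>j\<in>K. influence n j f) = 2 * cube_expectation n (\<lambda>x. f x * ?S x)" .
  consider "card K = 0" | "?L = 0" | "0 < card K" "0 < ?L"
    using Lam_nonneg[of n f] by fastforce
  then show ?thesis
  proof cases
    case 1
    with fin have "K = {}" by simp
    then show ?thesis by simp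
  next
    \<comment> \<open>Here \<open>ln 0 = 0\<close> and the claimed bound is 0. The threshold
      \<open>T = card K\<close> is never exceeded by the sum of spins, so the tail vanishes as
      well.\<close>
    case 2
    have "max 0 (\<bar>?S x\<bar> - ?m) = 0" if x: "x \<in> cube n" for x
    proof -
      have "\<bar>?S x\<bar> \<le> (\<Sum>j\<in>K. \<bar>spin j x\<bar>)" by (rule sum_abs)
      also have "\<dots> = (\<Sum>j\<in>K. 1)"
      proof (intro sum.cong refl)
        fix j assume "j \<in> K"
        then have "j \<in> {1..n}" using K by blast
        from spin_cases[OF x this] show "\<bar>spin j x\<bar> = 1" by auto
      qed
      finally show ?thesis by simp
    qed
    then have "cube_expectation n (\<lambda>x. max 0 (\<bar>?S x\<bar> - ?m)) = cube_expectation n (\<lambda>_. 0)"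
      by (rule cube_expectation_cong)
    with expectation_sum_spin_le[OF f mono K, of ?m] 2 show ?thesis
      unfolding infl by simp
  next
    case 3
    \<comment> \<open>The choice makes the Gaussian factor equal to \<open>?L * exp (- 1)\<close>.
      As the square of \<open>\<tau>\<close> is at least 2, the prefactor of the tail is at most
      \<open>T\<close>, so the tail costs no more than the main term \<open>T * ?L\<close>.\<close>
    define \<tau> where "\<tau> = sqrt (2 * (1 - ln ?L))"
    have ln: "ln ?L \<le> 0" using 3 Lam_le_1[OF f] by simp
    have \<tau>2: "\<tau>\<^sup>2 = 2 * (1 - ln ?L)" using ln by (simp add: \<tau>_def)
    have \<tau>: "0 < \<tau>" using ln by (simp add: \<tau>_def)
    define T where "T = sqrt ?m * \<tau>"
    have m: "0 < ?m" using 3 by simp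
    have T: "0 < T" using \<tau> m by (simp add: T_def)
    have T2: "T\<^sup>2 = ?m * \<tau>\<^sup>2" using m by (simp add: T_def power_mult_distrib)
    have "- (T\<^sup>2) / (2 * ?m) = - (\<tau>\<^sup>2) / 2" using m by (simp add: T2)
    also have "\<dots> = ln ?L + (- 1)" by (simp add: \<tau>2)
    finally have "exp (- (T\<^sup>2) / (2 * ?m)) = ?L * exp (- 1)"
      using 3 by (simp only: exp_add exp_ln)
    also have "\<dots> \<le> ?L * 1" using 3 by (intro mult_left_mono) auto
    finally have *: "exp (- (T\<^sup>2) / (2 * ?m)) \<le> ?L" by simp
    have **: "2 * ?m / T \<le> T"
    proof -
      have "2 \<le> \<tau>\<^sup>2" using ln \<tau>2 by simp
      from mult_left_mono[OF this, of ?m] have "2 * ?m \<le> T * T"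
        unfolding power2_eq_square[of T, symmetric] T2 by simp
      then show ?thesis using T by (simp only: pos_divide_le_eq)
    qed
    have "2 * ?m / T * exp (- (T\<^sup>2) / (2 * ?m)) \<le> T * ?L"
      by (rule mult_mono[OF ** *]) (use T in simp_all)
    then have "cube_expectation n (\<lambda>x. f x * ?S x) \<le> 2 * (T * ?L)"
      using expectation_sum_spin_le[OF f mono K less_imp_le[OF T]] sum_spin_tail[OF K T 3(1)]
      by linarith
    then show ?thesis unfolding infl T_def \<tau>_def by (simp add: mult_ac)
  qed
qed

text \<open>Removing a least element replaces sorting: it is at most the average, hence at most
  \<open>B / sqrt (card K)\<close>, and its square contributes the last term of the harmonic
  sum.\<close>

lemma sum_squares_le_harm:
  fixes a :: "'a \<Rightarrow> real"
  assumes "finite K" "\<And>j. j \<in> K \<Longrightarrow> 0 \<le> a j" "\<And>J. J \<subseteq> K \<Longrightarrow> sum a J \<le> B * sqrt (real (card J))"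
  shows "(\<Sum>j\<in>K. (a j)\<^sup>2) \<le> B\<^sup>2 * harm (card K)"
  using assms
proof (induction "card K" arbitrary: K)
  case 0
  then show ?case by (simp add: harm_def)
next
  case (Suc k)
  have "K \<noteq> {}" using Suc.hyps(2) by auto
  define j where "j = arg_min_on a K"
  have j: "j \<in> K" unfolding j_def using Suc.prems(1) \<open>K \<noteq> {}\<close> by (rule arg_min_if_finite)
  have min: "a j \<le> a i" if "i \<in> K" for i
    unfolding j_def using Suc.prems(1) \<open>K \<noteq> {}\<close> that by (rule arg_min_least)
  have "real (card K) * a j \<le> sum a K"
    using sum_bounded_below[of K "a j" a] min by simp
  also have "\<dots> \<le> B * sqrt (real (card K))" by (rule Suc.prems(3)) simp
  finally have "(real (card K) * a j)\<^sup>2 \<le> (B * sqrt (real (card K)))\<^sup>2"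
    using Suc.prems(2)[OF j] by (intro power_mono) auto
  then have "real (card K) * (real (card K) * (a j)\<^sup>2) \<le> real (card K) * B\<^sup>2"
    by (simp add: power_mult_distrib power2_eq_square mult_ac)
  then have "real (card K) * (a j)\<^sup>2 \<le> B\<^sup>2"
    by (rule mult_left_le_imp_le) (simp add: Suc.hyps(2)[symmetric])
  then have "(a j)\<^sup>2 \<le> B\<^sup>2 / real (card K)"
    by (intro mult_imp_le_div_pos) (simp_all add: Suc.hyps(2)[symmetric] mult.commute)
  then have aj: "(a j)\<^sup>2 \<le> B\<^sup>2 * inverse (real (card K))"
    by (simp add: divide_inverse)
  have card: "card (K - {j}) = k" using Suc.hyps(2) Suc.prems(1) j by simp
  have "(\<Sum>i\<in>K - {j}. (a i)\<^sup>2) \<le> B\<^sup>2 * harm (card (K - {j}))"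
    using Suc.prems by (intro Suc.hyps(1)) (auto simp: card)
  moreover have "(\<Sum>i\<in>K. (a i)\<^sup>2) = (a j)\<^sup>2 + (\<Sum>i\<in>K - {j}. (a i)\<^sup>2)"
    using Suc.prems(1) j by (rule sum.remove)
  ultimately show ?case using aj
    unfolding card Suc.hyps(2)[symmetric] by (simp add: harm_Suc distrib_left)
qed

lemma harm_le_ln:
  assumes "1 \<le> n"
  shows "harm n \<le> 1 + ln (real n)"
  using assms
proof (induction n rule: dec_induct)
  case base
  then show ?case by (simp add: harm_def)
next
  case (step n)
  have "ln (real n / real (Suc n)) \<le> real n / real (Suc n) - 1"
    using step.hyps by (intro ln_le_minus_one) simp
  also have "\<dots> = - inverse (real (Suc n))" by (simp add: field_simps)
  finally have "inverse (real (Suc n)) \<le> ln (real (Suc n)) - ln (real n)"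
    using step.hyps by (simp add: ln_div)
  with step.IH show ?case by (simp add: harm_Suc)
qed

lemma sum_sq_influences_le:
  assumes n: "2 \<le> n" and f: "f \<in> cube n \<rightarrow> {0..1}" and mono: "cube_monotone n f"
  shows "sum_sq_influences n f \<le> 96 * Lam_term (Lam n f) * ln (real n)"
proof -
  let ?L = "Lam n f"
  define B where "B = 4 * ?L * sqrt (2 * (1 - ln ?L))"
  have ln: "ln ?L \<le> 0"
    using Lam_le_1[OF f] Lam_nonneg[of n f] by (cases "?L = 0") auto
  have B2: "B\<^sup>2 = 32 * Lam_term ?L"
    using ln by (simp add: B_def power_mult_distrib Lam_term_def)
  \<comment> \<open>For \<open>n \<ge> 2\<close> the summand 1 in \<open>1 + ln n\<close> is at most
    \<open>3/2 * ln n\<close>. The resulting factor 3, with the 32 from the square of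
    \<open>B\<close>, makes 96.\<close>
  have "2 / 3 \<le> ln (2::real)" by (rule ln2_ge_two_thirds)
  also have "\<dots> \<le> ln (real n)" using n by simp
  finally have harm: "harm n \<le> 3 * ln (real n)" using harm_le_ln[of n] n by simp
  have "sum_sq_influences n f \<le> B\<^sup>2 * harm (card {1..n})"
    unfolding sum_sq_influences_def
  proof (rule sum_squares_le_harm)
    show "0 \<le> influence n j f" for j
      unfolding influence_def by (intro cube_expectation_nonneg) simp
    show "(\<Sum>j\<in>J. influence n j f) \<le> B * sqrt (real (card J))" if "J \<subseteq> {1..n}" for J
      unfolding B_def by (rule sum_influences_le[OF f mono that])
  qed simp
  also have "\<dots> \<le> B\<^sup>2 * (3 * ln (real n))"
    using harm by (intro mult_left_mono) auto
  finally show ?thesis by (simp add: B2)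
qed

section \<open>Noise sensitivity\<close>

text \<open>A coordinate of the noise has mass
  \<open>(1 + (1 - 2 * \<epsilon>) * spin j x * spin j y) / 2\<close> at \<open>y j\<close>;
  expanding the product over coordinates produces the Walsh functions.\<close>

lemma pmf_noise:
  assumes x: "x \<in> cube n" and y: "y \<in> cube n" and \<epsilon>: "0 \<le> \<epsilon>" "\<epsilon> \<le> 1"
  shows "pmf (noise n \<epsilon> x) y = (\<Sum>S\<in>Pow {1..n}. (1 - 2 * \<epsilon>) ^ card S * walsh S x * walsh S y) / 2 ^ n"
proof -
  have coord: "pmf (map_pmf (\<lambda>b. if b then 1 - x j else x j) (bernoulli_pmf \<epsilon>)) (y j) =
      (1 + (1 - 2 * \<epsilon>) * spin j x * spin j y) / 2" (is "pmf (map_pmf ?h _) _ = _") if j: "j \<in> {1..n}" for j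
  proof -
    have inj: "inj ?h" using cube_values[OF x j] by (auto simp: inj_def)
    define b where "b \<longleftrightarrow> x j \<noteq> y j"
    have b: "y j = ?h b" using cube_values[OF x j] cube_values[OF y j] by (auto simp: b_def)
    have "pmf (map_pmf ?h (bernoulli_pmf \<epsilon>)) (y j) = pmf (bernoulli_pmf \<epsilon>) b"
      unfolding b by (rule pmf_map_inj'[OF inj])
    also have "\<dots> = (1 + (1 - 2 * \<epsilon>) * spin j x * spin j y) / 2"
      using cube_values[OF x j] cube_values[OF y j] \<epsilon> by (auto simp: spin_def b_def)
    finally show ?thesis .
  qed
  have "pmf (noise n \<epsilon> x) y = (\<Prod>j\<in>{1..n}. (1 + (1 - 2 * \<epsilon>) * spin j x * spin j y) / 2)"
  proof -
    \<comment> \<open>The default value of \<open>Pi_pmf\<close> agrees with that of extensional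
      functions; otherwise the mass at \<open>y\<close> would be 0.\<close>
    have "y j = undefined" if "j \<notin> {1..n}" for j
      using y that by (auto simp: cube_def PiE_iff extensional_def)
    then have "pmf (noise n \<epsilon> x) y =
        (\<Prod>j\<in>{1..n}. pmf (map_pmf (\<lambda>b. if b then 1 - x j else x j) (bernoulli_pmf \<epsilon>)) (y j))"
      unfolding noise_def by (intro pmf_Pi') auto
    also have "\<dots> = (\<Prod>j\<in>{1..n}. (1 + (1 - 2 * \<epsilon>) * spin j x * spin j y) / 2)"
      by (intro prod.cong refl coord)
    finally show ?thesis .
  qed
  also have "\<dots> = (\<Prod>j\<in>{1..n}. (1 - 2 * \<epsilon>) * spin j x * spin j y + 1) / 2 ^ n"
    by (simp add: prod_dividef add.commute)
  also have "\<dots> = (\<Sum>S\<in>Pow {1..n}. (1 - 2 * \<epsilon>) ^ card S * walsh S x * walsh S y) / 2 ^ n"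
    by (simp add: prod_add prod.distrib walsh_def)
  finally show ?thesis .
qed

lemma prob_noise:
  assumes x: "x \<in> cube n" and A: "A \<subseteq> cube n" and \<epsilon>: "0 \<le> \<epsilon>" "\<epsilon> \<le> 1"
  shows "measure_pmf.prob (noise n \<epsilon> x) A =
    (\<Sum>S\<in>Pow {1..n}. (1 - 2 * \<epsilon>) ^ card S * walsh_coeff n (indicat_real A) S * walsh S x)"
proof -
  have fin: "finite A" using A by (rule finite_subset) simp
  have coeff: "walsh_coeff n (indicat_real A) S = (\<Sum>y\<in>A. walsh S y) / 2 ^ n" for S
  proof -
    have "(\<Sum>y\<in>cube n. indicat_real A y * walsh S y) = (\<Sum>y\<in>cube n \<inter> A. walsh S y)"
      by (simp add: sum.inter_restrict indicator_def if_distrib[of "\<lambda>u. u * _"] cong: if_cong)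
    then show ?thesis
      using A by (simp add: walsh_coeff_def cube_expectation_eq_sum inf.absorb2)
  qed
  have "measure_pmf.prob (noise n \<epsilon> x) A =
      (\<Sum>y\<in>A. (\<Sum>S\<in>Pow {1..n}. (1 - 2 * \<epsilon>) ^ card S * walsh S x * walsh S y) / 2 ^ n)"
    unfolding measure_measure_pmf_finite[OF fin] using A by (intro sum.cong refl pmf_noise x \<epsilon>) auto
  also have "\<dots> = (\<Sum>S\<in>Pow {1..n}. (1 - 2 * \<epsilon>) ^ card S * walsh S x * ((\<Sum>y\<in>A. walsh S y) / 2 ^ n))"
    unfolding sum_divide_distrib sum_distrib_left by (subst sum.swap) simp
  finally show ?thesis by (simp only: coeff mult_ac)
qed

text \<open>The noise multiplies the coefficient at \<open>S\<close> by
  \<open>(1 - 2 * \<epsilon>) ^ card S\<close>. The empty set contributes the probability of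
  \<open>A\<close>, and orthonormality gives the rest.\<close>

lemma noise_variance:
  assumes A: "A \<subseteq> cube n" and \<epsilon>: "0 \<le> \<epsilon>" "\<epsilon> \<le> 1"
  shows "cube_expectation n (\<lambda>x. (measure_pmf.prob (noise n \<epsilon> x) A - cube_prob n A)\<^sup>2) =
    (\<Sum>S\<in>Pow {1..n} - {{}}. ((1 - 2 * \<epsilon>)\<^sup>2) ^ card S * (walsh_coeff n (indicat_real A) S)\<^sup>2)"
proof -
  let ?a = "\<lambda>S. (1 - 2 * \<epsilon>) ^ card S * walsh_coeff n (indicat_real A) S"
  have "measure_pmf.prob (noise n \<epsilon> x) A - cube_prob n A = (\<Sum>S\<in>Pow {1..n} - {{}}. ?a S * walsh S x)"
    if "x \<in> cube n" for x
  proof -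
    have "(\<Sum>S\<in>Pow {1..n}. ?a S * walsh S x) = ?a {} * walsh {} x + (\<Sum>S\<in>Pow {1..n} - {{}}. ?a S * walsh S x)"
      by (rule sum.remove) auto
    then show ?thesis unfolding prob_noise[OF that A \<epsilon>] by (simp add: walsh_coeff_def)
  qed
  then have "cube_expectation n (\<lambda>x. (measure_pmf.prob (noise n \<epsilon> x) A - cube_prob n A)\<^sup>2) =
      cube_expectation n (\<lambda>x. (\<Sum>S\<in>Pow {1..n} - {{}}. ?a S * walsh S x)\<^sup>2)"
    by (intro cube_expectation_cong) simp
  also have "\<dots> = (\<Sum>S\<in>Pow {1..n} - {{}}. (?a S)\<^sup>2)"
    by (rule walsh_sum_square) auto
  also have "\<dots> = (\<Sum>S\<in>Pow {1..n} - {{}}. ((1 - 2 * \<epsilon>)\<^sup>2) ^ card S * (walsh_coeff n (indicat_real A) S)\<^sup>2)"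
    by (simp add: power_mult_distrib mult.commute flip: power_mult)
  finally show ?thesis .
qed

text \<open>Sets of size at most \<open>k\<close> are absorbed by the bound with base 1/6 at the
  price \<open>6 ^ k\<close>; larger sets have a small multiplier and total weight at most
  1.\<close>

lemma noise_variance_le:
  assumes A: "monotone_event n A" and \<epsilon>: "0 \<le> \<epsilon>" "\<epsilon> \<le> 1" and t: "0 < t"
  shows "cube_expectation n (\<lambda>x. (measure_pmf.prob (noise n \<epsilon> x) A - cube_prob n A)\<^sup>2)
    \<le> 6 ^ k * (t * sqrt (sum_sq_influences n (indicat_real A)) + 1 / t) + ((1 - 2 * \<epsilon>)\<^sup>2) ^ k"
proof -
  let ?f = "indicat_real A"
  let ?c = "\<lambda>S. (walsh_coeff n ?f S)\<^sup>2"
  let ?q = "(1 - 2 * \<epsilon>)\<^sup>2"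
  let ?F = "Pow {1..n} - {{}}"
  have sub: "A \<subseteq> cube n" and mono: "cube_monotone n ?f"
    using A by (auto simp: monotone_event_def)
  have q: "0 \<le> ?q" "?q \<le> 1" using \<epsilon> by (auto simp: abs_square_le_1 abs_le_iff)
  have "?q ^ card S \<le> 6 ^ k * (1/6) ^ card S + ?q ^ k" for S :: "nat set"
  proof (cases "card S \<le> k")
    case True
    then have "(1::real) \<le> 6 ^ k * (1/6) ^ card S"
      by (simp add: power_divide power_increasing)
    moreover have "?q ^ card S \<le> 1" "0 \<le> ?q ^ k" using q by (simp_all add: power_le_one)
    ultimately show ?thesis by linarith
  next
    case False
    then have "?q ^ card S \<le> ?q ^ k" using q by (intro power_decreasing) auto
    then show ?thesis by (simp add: add_increasing)
  qed
  then have "(\<Sum>S\<in>?F. ?q ^ card S * ?c S) \<le> (\<Sum>S\<in>?F. (6 ^ k * (1/6) ^ card S + ?q ^ k) * ?c S)"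
    by (intro sum_mono mult_right_mono) auto
  also have "\<dots> = 6 ^ k * (\<Sum>S\<in>?F. (1/6) ^ card S * ?c S) + ?q ^ k * (\<Sum>S\<in>?F. ?c S)"
    by (simp only: distrib_right sum.distrib sum_distrib_left mult.assoc)
  also have "\<dots> \<le> 6 ^ k * (t * sqrt (sum_sq_influences n ?f) + 1 / t) + ?q ^ k * 1"
  proof (intro add_mono mult_left_mono)
    show "(\<Sum>S\<in>?F. (1/6) ^ card S * ?c S) \<le> t * sqrt (sum_sq_influences n ?f) + 1 / t"
      by (rule noisy_weight_bound[OF _ mono t]) (auto simp: indicator_def)
    have "(\<Sum>S\<in>?F. ?c S) \<le> cube_expectation n (\<lambda>x. (?f x)\<^sup>2)"
      by (rule walsh_bessel) auto
    also have "\<dots> \<le> cube_expectation n (\<lambda>_. 1)"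
      by (rule cube_expectation_mono) (auto simp: indicator_def)
    finally show "(\<Sum>S\<in>?F. ?c S) \<le> 1" by simp
  qed (use q in auto)
  finally show ?thesis unfolding noise_variance[OF sub \<epsilon>] by simp
qed

section \<open>From the variance to the sensitivity gauge\<close>

text \<open>Chebyshev's inequality.\<close>

lemma sens_gamma_le:
  assumes "0 < \<delta>"
  shows "sens_gamma n A \<epsilon> \<delta> \<le>
    cube_expectation n (\<lambda>x. (measure_pmf.prob (noise n \<epsilon> x) A - cube_prob n A)\<^sup>2) / \<delta>\<^sup>2"
proof -
  let ?d = "\<lambda>x. measure_pmf.prob (noise n \<epsilon> x) A - cube_prob n A"
  let ?B = "{x \<in> cube n. \<bar>?d x\<bar> > \<delta>}"
  have "sens_gamma n A \<epsilon> \<delta> = cube_expectation n (indicat_real ?B)"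
    by (simp add: sens_gamma_def)
  also have "\<dots> \<le> cube_expectation n (\<lambda>x. (?d x)\<^sup>2 / \<delta>\<^sup>2)"
  proof (rule cube_expectation_mono)
    fix x
    have "1 \<le> (?d x)\<^sup>2 / \<delta>\<^sup>2" if "\<delta> < \<bar>?d x\<bar>"
      using that assms power_mono[of \<delta> "\<bar>?d x\<bar>" 2] by simp
    then show "indicat_real ?B x \<le> (?d x)\<^sup>2 / \<delta>\<^sup>2" by (auto simp: indicator_def)
  qed
  finally show ?thesis by simp
qed

lemma sens_phi_nonneg: "0 \<le> sens_phi n A \<epsilon>"
proof -
  \<comment> \<open>As \<open>sens_gamma\<close> is a probability, 2 is admissible in the infimum;
    nonemptiness matters because \<open>Inf\<close> of the empty set has no useful value on the
    reals.\<close>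
  have "sens_gamma n A \<epsilon> 2 \<le> 1" by (simp add: sens_gamma_def)
  then have "2 \<in> {\<delta>. \<delta> > 0 \<and> sens_gamma n A \<epsilon> \<delta> < \<delta>}" by simp
  then have "{\<delta>. \<delta> > 0 \<and> sens_gamma n A \<epsilon> \<delta> < \<delta>} \<noteq> {}" by blast
  then show ?thesis unfolding sens_phi_def by (rule cInf_greatest) simp
qed

lemma sens_phi_le:
  assumes "0 < \<delta>" "sens_gamma n A \<epsilon> \<delta> < \<delta>"
  shows "sens_phi n A \<epsilon> \<le> \<delta>"
  unfolding sens_phi_def using assms by (intro cInf_lower bdd_belowI[where m = 0]) auto

lemma asymp_noise_sensitive_if_influences:
  assumes A: "\<And>m. monotone_event (N m) (A m)"
    and II: "(\<lambda>m. sum_sq_influences (N m) (indicat_real (A m))) \<longlonglongrightarrow> 0"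
  shows "asymp_noise_sensitive N A"
  unfolding asymp_noise_sensitive_def
proof (intro allI impI)
  fix \<epsilon> :: real
  assume \<epsilon>: "0 < \<epsilon> \<and> \<epsilon> < 1 / 2"
  let ?s = "\<lambda>m. sqrt (sum_sq_influences (N m) (indicat_real (A m)))"
  let ?q = "(1 - 2 * \<epsilon>)\<^sup>2"
  have q: "0 \<le> ?q" "?q < 1" using \<epsilon> by (auto simp: abs_square_less_1)
  have s: "?s \<longlonglongrightarrow> 0" using tendsto_real_sqrt[OF II] by simp
  have small: "\<forall>\<^sub>F m in sequentially. sens_phi (N m) (A m) \<epsilon> \<le> \<delta>" if \<delta>: "0 < \<delta>" for \<delta>
  proof -
    have \<delta>3: "0 < \<delta> ^ 3 / 3" using \<delta> by simp
    \<comment> \<open>The target is a variance below \<open>\<delta> ^ 3\<close>, so that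
      Chebyshev's inequality gives a probability below \<open>\<delta>\<close>. Each of three terms
      gets a third: \<open>k\<close> handles the large sets, then \<open>t\<close> makes
      \<open>6 ^ k / t\<close> a third, and finally large \<open>m\<close> handles the
      influences.\<close>
    obtain k where k: "?q ^ k < \<delta> ^ 3 / 3"
      using real_arch_pow_inv[OF \<delta>3 q(2)] by blast
    define t where "t = 6 ^ k * 3 / \<delta> ^ 3"
    have t: "0 < t" using \<delta> by (simp add: t_def)
    have "(\<lambda>m. 6 ^ k * t * ?s m) \<longlonglongrightarrow> 6 ^ k * t * 0" by (intro tendsto_mult_left s)
    then have "\<forall>\<^sub>F m in sequentially. 6 ^ k * t * ?s m < \<delta> ^ 3 / 3"
      using \<delta>3 by (intro order_tendstoD(2)) auto
    then show ?thesis
    proof eventually_elim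
      case (elim m)
      let ?v = "cube_expectation (N m) (\<lambda>x. (measure_pmf.prob (noise (N m) \<epsilon> x) (A m) - cube_prob (N m) (A m))\<^sup>2)"
      have "?v \<le> 6 ^ k * (t * ?s m + 1 / t) + ?q ^ k"
        using \<epsilon> by (intro noise_variance_le A t) auto
      also have "\<dots> = 6 ^ k * t * ?s m + \<delta> ^ 3 / 3 + ?q ^ k"
        using \<delta> by (simp add: t_def distrib_left)
      also have "\<dots> < \<delta> ^ 3" using elim k by simp
      finally have "?v / \<delta>\<^sup>2 < \<delta>" using \<delta> by (simp add: divide_less_eq power2_eq_square power3_eq_cube mult_ac)
      then show ?case
        using sens_gamma_le[OF \<delta>, of "N m" "A m" \<epsilon>] by (intro sens_phi_le \<delta>) simp
    qed
  qed
  show "(\<lambda>m. sens_phi (N m) (A m) \<epsilon>) \<longlonglongrightarrow> 0"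
  proof (rule LIMSEQ_I)
    fix r :: real assume "0 < r"
    then obtain m0 where "\<forall>m\<ge>m0. sens_phi (N m) (A m) \<epsilon> \<le> r / 2"
      using small[of "r / 2"] by (auto simp: eventually_sequentially)
    with \<open>0 < r\<close> show "\<exists>m0. \<forall>m\<ge>m0. norm (sens_phi (N m) (A m) \<epsilon> - 0) < r"
      using sens_phi_nonneg by (intro exI[of _ m0]) (fastforce simp: abs_of_nonneg)
  qed
qed

theorem theorem1p6:
  shows "(\<exists>C::real. \<forall>(n::nat) (f :: (nat \<Rightarrow> nat) \<Rightarrow> real).
            n \<ge> 2 \<longrightarrow> f \<in> cube n \<rightarrow> {0..1} \<longrightarrow> cube_monotone n f \<longrightarrow>
            sum_sq_influences n f \<le> C * Lam_term (Lam n f) * ln (real n))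
       \<and> (\<forall>(N :: nat \<Rightarrow> nat) (A :: nat \<Rightarrow> (nat \<Rightarrow> nat) set).
            (\<forall>m. N m \<ge> 2) \<longrightarrow> (\<forall>m. monotone_event (N m) (A m)) \<longrightarrow>
            (\<lambda>m. Lam_term (Lam (N m) (indicat_real (A m))) * ln (real (N m))) \<longlonglongrightarrow> 0 \<longrightarrow>
            asymp_noise_sensitive N A)"
proof (intro conjI allI impI exI[of _ 96])
  fix n and f :: "(nat \<Rightarrow> nat) \<Rightarrow> real"
  assume "n \<ge> 2" "f \<in> cube n \<rightarrow> {0..1}" "cube_monotone n f"
  then show "sum_sq_influences n f \<le> 96 * Lam_term (Lam n f) * ln (real n)"
    by (rule sum_sq_influences_le)
next
  fix N :: "nat \<Rightarrow> nat" and A :: "nat \<Rightarrow> (nat \<Rightarrow> nat) set"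
  assume N: "\<forall>m. N m \<ge> 2" and A: "\<forall>m. monotone_event (N m) (A m)"
    and lim: "(\<lambda>m. Lam_term (Lam (N m) (indicat_real (A m))) * ln (real (N m))) \<longlonglongrightarrow> 0"
  have "(\<lambda>m. sum_sq_influences (N m) (indicat_real (A m))) \<longlonglongrightarrow> 0"
  proof (rule tendsto_sandwich[OF always_eventually always_eventually tendsto_const])
    show "\<forall>m. 0 \<le> sum_sq_influences (N m) (indicat_real (A m))"
      by (simp add: sum_sq_influences_def sum_nonneg)
    show "\<forall>m. sum_sq_influences (N m) (indicat_real (A m)) \<le>
        96 * (Lam_term (Lam (N m) (indicat_real (A m))) * ln (real (N m)))"
      using N A by (auto simp: monotone_event_def indicator_def mult.assoc[symmetric] intro!: sum_sq_influences_le)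
    show "(\<lambda>m. 96 * (Lam_term (Lam (N m) (indicat_real (A m))) * ln (real (N m)))) \<longlonglongrightarrow> 0"
      using tendsto_mult_left[OF lim, of 96] by simp
  qed
  with A show "asymp_noise_sensitive N A"
    by (intro asymp_noise_sensitive_if_influences) auto
qed

end
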